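(* If $k\ge 2$ is an integer, then $$\lim_{N\to\infty}\ \lim_{q\to 1}F_{\mathcal{S}^{(k)}_{\mathrm{fr}}(N)}(q)=\frac{1}{\zeta(k)}.$$ Furthermore, if $k\ge 2$ is even, then $$\lim_{N\to\infty}\ \lim_{q\to 1}F_{\mathcal{S}^{(k)}_{\mathrm{fr}}(N)}(q)=(-1)^{\frac k2+1}\,\frac{k!}{B_k\cdot 2^{k-1}}\cdot\frac{1}{\pi^k},$$ where $B_k$ is the $k$th Bernoulli number. Here the inner limits are taken as $q$ tends to $1$ from within the unit disk.
   Context: $\zeta$ is the Riemann zeta function. For integers $k,N\ge 2$, $\mathcal{S}^{(k)}_{\mathrm{fr}}(N)=\{n\ge 1: p^k\nmid n\text{ for every prime }p\le N\}$; the set $\mathcal{S}^{(k)}_{\mathrm{fr}}$ of $k$th power-free positive integers is the intersection of these sets over all $N$. The paper's symbol $\lim_{q\to1}F_{\mathcal{S}^{(k)}_{\mathrm{fr}}}(q)$ is understood as the iterated limit $\lim_{N\to\infty}\lim_{q\to 1}F_{\mathcal{S}^{(k)}_{\mathrm{fr}}(N)}(q)$. A partition is a finite non-increasing sequence of positive integers $\lambda=(\lambda_1,\dots,\lambda_{\ell(\lambda)})$; $\mathcal{P}$ is the set of all partitions, $\ell(\lambda)$ is the number of parts, $|\lambda|=\lambda_1+\cdots+\lambda_{\ell(\lambda)}$ is the size, and $\mathrm{sm}(\lambda)=\lambda_{\ell(\lambda)}$ is the smallest part (defined for nonempty $\lambda$). The partition-theoretic Möbius function is $\mu_{\mathcal{P}}(\lambda)=0$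 if $\lambda$ has repeated parts and $\mu_{\mathcal{P}}(\lambda)=(-1)^{\ell(\lambda)}$ otherwise; put $\mu^*_{\mathcal{P}}(\lambda)=-\mu_{\mathcal{P}}(\lambda)$. For a set $\mathcal{S}$ of positive integers and $|q|<1$, define $$F_{\mathcal{S}}(q)=\sum_{\lambda\in\mathcal{P},\ \mathrm{sm}(\lambda)\in\mathcal{S}}\mu^*_{\mathcal{P}}(\lambda)q^{|\lambda|},$$ the sum running over nonempty partitions whose smallest part lies in $\mathcal{S}$.
   Formalization: The inner limits "as q tends to 1 from within the unit disk" are taken nontangentially, in a region |1-q| < C(1-|q|) with some C > 1 that may depend on N (this includes radial approach); for unrestricted approach the claim fails, already for k = N = 2, as F is unbounded near 1. *)

theory Defs
  imports
    "HOL-Analysis.Analysis"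
    "HOL-Computational_Algebra.Computational_Algebra"
begin

definition is_partition :: "nat list \<Rightarrow> bool" where
  "is_partition xs \<longleftrightarrow> sorted_wrt (\<ge>) xs \<and> (\<forall>x\<in>set xs. x > 0)"

definition partitions :: "nat list set" where
  "partitions = {xs. is_partition xs}"

definition mu_partition :: "nat list \<Rightarrow> int" where
  "mu_partition xs = (if distinct xs then (-1) ^ length xs else 0)"

definition mu_partition_star :: "nat list \<Rightarrow> int" where
  "mu_partition_star xs = - mu_partition xs"

text \<open>The size of a partition is its \<^const>\<open>sum_list\<close>; the smallest part of a nonempty
  partition is its \<^const>\<open>last\<close> entry, since parts are listed in non-increasing order.
  The sum converges absolutely for \<open>|q| < 1\<close>; other values of \<open>q\<close> are irrelevant.\<close>

definition F_series :: "nat set \<Rightarrow> complex \<Rightarrow> complex" where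
  "F_series S q =
     (\<Sum>\<^sub>\<infinity>xs\<in>{xs \<in> partitions. xs \<noteq> [] \<and> last xs \<in> S}.
        of_int (mu_partition_star xs) * q ^ sum_list xs)"

definition S_fr :: "nat \<Rightarrow> nat \<Rightarrow> nat set" where
  "S_fr k N = {n. n \<ge> 1 \<and> (\<forall>p. prime p \<and> p \<le> N \<longrightarrow> \<not> p ^ k dvd n)}"

text \<open>The Riemann zeta function on its half-plane of absolute convergence \<open>Re s > 1\<close>; no
  analytic continuation is provided elsewhere.\<close>

definition zeta :: "complex \<Rightarrow> complex" where
  "zeta s = (\<Sum>n. 1 / of_nat (Suc n) powr s)"

text \<open>Bernoulli numbers, by \<open>t / (e\<^sup>t - 1) = (\<Sum>n. B\<^sub>n t\<^sup>n / n!)\<close>.\<close>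

definition bernoulli :: "nat \<Rightarrow> real" where
  "bernoulli n = fact n * fps_nth (fps_X / (fps_exp 1 - 1)) n"

text \<open>Convergence of \<open>f q\<close> as \<open>q\<close> tends to \<open>1\<close> from within the unit disk, understood
  nontangentially: \<open>q\<close> is complex and ranges over a Stolz region at \<open>1\<close>. For \<open>C > 1\<close> such a
  region contains the radius \<open>{0<..<1}\<close> and has positive opening angle on both sides of it.
  The regions are nested, so the limit does not depend on \<open>C\<close>.

  Approach along arbitrary paths in the disk would be too much to ask of \<^const>\<open>F_series\<close>:
  \<open>F_series (S_fr k N)\<close> is unbounded in every neighbourhood of \<open>1\<close> within the disk (it blows
  up radially at roots of unity accumulating at \<open>1\<close>), and the opening angle for which the
  limit exists shrinks as \<open>N\<close> grows, so that no fixed \<open>C\<close> serves every \<open>N\<close>.\<close>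

definition stolz_region :: "real \<Rightarrow> complex set" where
  "stolz_region C = {q. norm q < 1 \<and> norm (1 - q) < C * (1 - norm q)}"

definition tendsto_at_1_in_disk :: "(complex \<Rightarrow> complex) \<Rightarrow> complex \<Rightarrow> bool" where
  "tendsto_at_1_in_disk f L \<longleftrightarrow> (\<exists>C>1. (f \<longlongrightarrow> L) (at 1 within stolz_region C))"

end

theory Submission
  imports Defs "HOL-Complex_Analysis.Complex_Analysis"
begin

text \<open>
  Only partitions into distinct parts contribute to \<^term>\<open>F_series S q\<close>. Such a partition with
  smallest part \<open>n\<close> consists of \<open>n\<close> and a finite set of parts beyond \<open>n\<close>, so
  \<open>F_S(q) = \<Sum>\<^sub>n\<^sub>\<in>\<^sub>S q^n (q^(n+1);q)\<^sub>\<infinity>\<close> with \<open>(a;q)\<^sub>\<infinity> = \<Prod>\<^sub>j (1 - a q^j)\<close> (lemma \<open>has_sum_F_series\<close>).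

  In a Stolz region individual terms of this series can be exponentially large, and the limit
  depends on cancellation. Fourier analysis in \<open>n\<close> makes the cancellation explicit. Twisting by a
  root of unity \<open>\<zeta>\<close>, Euler's case of the q-binomial theorem gives
  \<open>\<Sum>\<^sub>n \<zeta>^n q^n (q^(n+1);q)\<^sub>\<infinity> = (q;q)\<^sub>\<infinity> / (\<zeta>q;q)\<^sub>\<infinity>\<close>, which is \<open>1\<close> for \<open>\<zeta> = 1\<close>. For \<open>\<zeta> \<noteq> 1\<close> its
  logarithm is asymptotic to \<open>(Li\<^sub>2(\<zeta>) - Li\<^sub>2(1)) / (1 - q)\<close>. The numerator has negative real part,
  so the quotient tends to \<open>0\<close> when \<open>q\<close> approaches \<open>1\<close> in a Stolz region that is narrow enough
  for \<open>\<zeta>\<close> (lemma \<open>qpoch_quotient_tendsto_0\<close>). Averaging over the \<open>m\<close>-th roots of unity, the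
  partitions with smallest part divisible by \<open>m\<close> contribute \<open>1/m\<close> in the limit.

  Inclusion and exclusion over the primes \<open>p \<le> N\<close> writes the indicator of \<^term>\<open>S_fr k N\<close> as a signed
  sum of indicators of multiples of \<open>(\<Prod>p\<in>A. p^k)\<close>, and the inner limit is therefore
  \<open>\<Prod>p\<le>N. 1 - p^(-k)\<close>. By the Euler product this tends to \<open>1/\<zeta>(k)\<close>.

  For even \<open>k\<close> the value of \<open>\<zeta>(k)\<close> comes from comparing two expansions of \<open>\<pi>z cot(\<pi>z)\<close> at \<open>0\<close>: one
  through the reflection formula of the Gamma function, in which the Taylor coefficients of the
  Digamma function at \<open>1\<close> are zeta values up to sign, and one through the generating function of
  the Bernoulli numbers.
\<close>

section \<open>The infinite q-Pochhammer symbol\<close>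

text \<open>The power series of \<open>-log (a;q)\<^sub>\<infinity>\<close>, obtained by expanding each \<open>-log (1 - a q^j)\<close> in powers
  of \<open>a\<close> and summing the geometric series over \<open>j\<close>. Its behaviour at \<open>q = 1\<close> can be read off
  termwise.\<close>

definition qlog :: "complex \<Rightarrow> complex \<Rightarrow> complex" where
  "qlog a q = (\<Sum>m. a ^ Suc m / (of_nat (Suc m) * (1 - q ^ Suc m)))"

text \<open>The infinite product \<open>(a;q)\<^sub>\<infinity>\<close>. Taking the exponential of the series as the definition makes it
  visibly nonzero; \<open>qpoch_LIMSEQ\<close> below identifies it with the product.\<close>

definition qpoch :: "complex \<Rightarrow> complex \<Rightarrow> complex" where
  "qpoch a q = exp (- qlog a q)"

lemma norm_one_minus_power_ge:
  fixes q :: complex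
  assumes "norm q < 1"
  shows "1 - norm q \<le> norm (1 - q ^ Suc m)"
proof -
  have "norm (q ^ Suc m) \<le> norm q"
    using assms by (simp add: norm_mult norm_power mult_left_le power_le_one)
  thus ?thesis using norm_triangle_ineq2[of 1 "q ^ Suc m"] by simp
qed

lemma norm_qlog_term_le:
  fixes a q :: complex
  assumes "norm q < 1"
  shows "norm (a ^ Suc m / (of_nat (Suc m) * (1 - q ^ Suc m))) \<le> norm a ^ Suc m / (1 - norm q)"
proof -
  have "1 * (1 - norm q) \<le> norm (of_nat (Suc m) :: complex) * norm (1 - q ^ Suc m)"
    using norm_one_minus_power_ge[OF assms] assms unfolding norm_of_nat
    by (intro mult_mono) auto
  thus ?thesis using assms unfolding norm_divide norm_mult norm_power
    by (intro divide_left_mono) (auto simp: less_le_trans[of 0 "1 - norm q"])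
qed

lemma sums_geometric_from_1:
  assumes "norm (a :: complex) < 1"
  shows "(\<lambda>m. norm a ^ Suc m / c) sums (norm a / (1 - norm a) / c)"
  using sums_mult2[OF geometric_sums[of "norm a"], of "norm a / c"] assms by (simp add: mult_ac)

lemma summable_qlog:
  fixes a q :: complex
  assumes "norm q < 1" "norm a < 1"
  shows "summable (\<lambda>m. a ^ Suc m / (of_nat (Suc m) * (1 - q ^ Suc m)))"
  by (rule summable_comparison_test'[where N = 0, OF sums_summable[OF sums_geometric_from_1[OF assms(2)]]])
     (rule norm_qlog_term_le[OF assms(1)])

lemma norm_qlog_le:
  assumes "norm q < 1" "norm a < 1"
  shows "norm (qlog a q) \<le> norm a / (1 - norm a) / (1 - norm q)"
proof -
  have s: "summable (\<lambda>m. norm a ^ Suc m / (1 - norm q))"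
    "(\<Sum>m. norm a ^ Suc m / (1 - norm q)) = norm a / (1 - norm a) / (1 - norm q)"
    by (rule sums_geometric_from_1[OF assms(2), THEN sums_summable])
       (rule sums_geometric_from_1[OF assms(2), THEN sums_unique, symmetric])
  show ?thesis unfolding qlog_def s(2)[symmetric]
    by (rule norm_suminf_le[OF norm_qlog_term_le[OF assms(1)] s(1)])
qed

text \<open>Replacing \<open>a\<close> by \<open>a q\<close> cancels the factor \<open>1 - q^m\<close> in the denominators and leaves the
  logarithmic series: this is the removal of the first factor of the product.\<close>

lemma qlog_diff:
  assumes "norm q < 1" "norm a < 1"
  shows "qlog a q - qlog (a * q) q = - Ln (1 - a)"
proof -
  have aq: "norm (a * q) < 1"
    using mult_strict_mono[of "norm a" 1 "norm q" 1] assms by (simp add: norm_mult)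
  have nz: "1 - q ^ Suc m \<noteq> 0" for m
    using norm_one_minus_power_ge[OF assms(1), of m] assms(1) by auto
  have "qlog a q - qlog (a * q) q = (\<Sum>m. a ^ Suc m / of_nat (Suc m))"
    unfolding qlog_def suminf_diff[OF summable_qlog[OF assms] summable_qlog[OF assms(1) aq]]
  proof (intro suminf_cong)
    fix m
    have "a ^ Suc m / (of_nat (Suc m) * (1 - q ^ Suc m)) - (a * q) ^ Suc m / (of_nat (Suc m) * (1 - q ^ Suc m))
      = a ^ Suc m * (1 - q ^ Suc m) / (of_nat (Suc m) * (1 - q ^ Suc m))"
      by (simp only: power_mult_distrib right_diff_distrib diff_divide_distrib mult_1_right)
    also have "\<dots> = a ^ Suc m / of_nat (Suc m)"
      using nz[of m] by (simp del: power_Suc of_nat_Suc)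
    finally show "a ^ Suc m / (of_nat (Suc m) * (1 - q ^ Suc m)) - (a * q) ^ Suc m / (of_nat (Suc m) * (1 - q ^ Suc m))
      = a ^ Suc m / of_nat (Suc m)" .
  qed
  also have "(\<lambda>n. ((-1) ^ Suc n / of_nat n) * (- a) ^ n) sums Ln (1 + (- a))"
    using assms(2) by (intro Ln_series) auto
  hence "(\<lambda>n. - (((-1) ^ Suc n / of_nat n) * (- a) ^ n)) sums - Ln (1 - a)"
    by (intro sums_minus) simp
  hence "(\<lambda>n. a ^ n / of_nat n) sums - Ln (1 - a)"
    by (simp flip: power_mult_distrib)
  hence "(\<lambda>m. a ^ Suc m / of_nat (Suc m)) sums - Ln (1 - a)"
    using sums_Suc_iff[of "\<lambda>n. a ^ n / of_nat n" "- Ln (1 - a)"] by simp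
  hence "(\<Sum>m. a ^ Suc m / of_nat (Suc m)) = - Ln (1 - a)" by (simp add: sums_iff)
  finally show ?thesis .
qed

lemma qpoch_rec:
  assumes "norm q < 1" "norm a < 1"
  shows "qpoch a q = (1 - a) * qpoch (a * q) q"
proof -
  have "- qlog a q = Ln (1 - a) + - qlog (a * q) q" using qlog_diff[OF assms] by (simp add: algebra_simps)
  hence "qpoch a q = exp (Ln (1 - a)) * qpoch (a * q) q" by (simp only: qpoch_def exp_add)
  moreover have "1 - a \<noteq> 0" using assms by auto
  ultimately show ?thesis by simp
qed

lemma norm_mult_power_less_1:
  fixes a q :: complex
  assumes "norm q < 1" "norm a < 1"
  shows "norm (a * q ^ N) < 1"
  using mult_left_le[of "norm q ^ N" "norm a"] power_le_one[of "norm q" N] assms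
  by (simp add: norm_mult norm_power)

lemma qpoch_tendsto_1:
  assumes "norm q < 1" "norm a < 1"
  shows "(\<lambda>N. qpoch (a * q ^ N) q) \<longlonglongrightarrow> 1"
proof -
  have "(\<lambda>N. norm (a * q ^ N)) \<longlonglongrightarrow> 0"
    using assms by (intro tendsto_norm_zero tendsto_mult_right_zero LIMSEQ_power_zero)
  hence "(\<lambda>N. norm (a * q ^ N) / (1 - norm (a * q ^ N)) / (1 - norm q)) \<longlonglongrightarrow> 0 / (1 - 0) / (1 - norm q)"
    using assms by (intro tendsto_intros) auto
  hence "(\<lambda>N. norm (a * q ^ N) / (1 - norm (a * q ^ N)) / (1 - norm q)) \<longlonglongrightarrow> 0"
    by simp
  hence "(\<lambda>N. qlog (a * q ^ N) q) \<longlonglongrightarrow> 0"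
    by (rule Lim_null_comparison[OF always_eventually, rotated])
       (use norm_qlog_le[OF assms(1) norm_mult_power_less_1[OF assms]] in blast)
  hence "(\<lambda>N. exp (- qlog (a * q ^ N) q)) \<longlonglongrightarrow> exp (- 0)"
    by (intro tendsto_intros)
  thus ?thesis by (simp add: qpoch_def)
qed

lemma qpoch_LIMSEQ:
  assumes "norm q < 1" "norm a < 1"
  shows "(\<lambda>N. \<Prod>j<N. 1 - a * q ^ j) \<longlonglongrightarrow> qpoch a q"
proof -
  have "qpoch a q = (\<Prod>j<N. 1 - a * q ^ j) * qpoch (a * q ^ N) q" for N
  proof (induction N)
    case (Suc N)
    thus ?case using qpoch_rec[OF assms(1) norm_mult_power_less_1[OF assms, of N]]
      by (simp add: mult_ac)
  qed simp
  hence "(\<Prod>j<N. 1 - a * q ^ j) = qpoch a q / qpoch (a * q ^ N) q" for N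
    by (simp add: eq_divide_eq qpoch_def)
  moreover have "(\<lambda>N. qpoch a q / qpoch (a * q ^ N) q) \<longlonglongrightarrow> qpoch a q / 1"
    by (intro tendsto_intros qpoch_tendsto_1 assms) auto
  ultimately show ?thesis by simp
qed

section \<open>Summing over strict partitions by smallest part\<close>

text \<open>A product over a finite set \<open>B\<close> is one term in the expansion of \<open>\<Prod>j. 1 + g j\<close>.\<close>

lemma sum_Pow_prod_le_exp:
  fixes g :: "nat \<Rightarrow> real"
  assumes "\<And>j. g j \<ge> 0" "summable g" "finite X" "X \<subseteq> {B. finite B}"
  shows "(\<Sum>B\<in>X. \<Prod>j\<in>B. g j) \<le> exp (suminf g)"
proof -
  have fin: "finite (\<Union>X)" using assms by auto
  have "(\<Sum>B\<in>X. \<Prod>j\<in>B. g j) \<le> (\<Sum>B\<in>Pow (\<Union>X). \<Prod>j\<in>B. g j)"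
    using assms fin by (intro sum_mono2) (auto intro!: prod_nonneg)
  also have "\<dots> = (\<Prod>j\<in>\<Union>X. g j + 1)" by (simp add: prod_add[OF fin])
  also have "\<dots> \<le> (\<Prod>j\<in>\<Union>X. exp (g j))"
    using assms(1) by (intro prod_mono) (auto simp: add.commute intro: add_nonneg_nonneg exp_ge_add_one_self)
  also have "\<dots> = exp (sum g (\<Union>X))" using fin by (simp add: exp_sum)
  also have "\<dots> \<le> exp (suminf g)" using fin assms by (simp add: sum_le_suminf)
  finally show ?thesis .
qed

lemma
  fixes g :: "nat \<Rightarrow> real"
  assumes "\<And>j. g j \<ge> 0" "summable g"
  shows summable_on_finite_sets_prod: "(\<lambda>B. \<Prod>j\<in>B. g j) summable_on {B. finite B}"
    and infsum_finite_sets_prod_le: "(\<Sum>\<^sub>\<infinity>B\<in>{B. finite B}. \<Prod>j\<in>B. g j) \<le> exp (suminf g)"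
proof -
  show s: "(\<lambda>B. \<Prod>j\<in>B. g j) summable_on {B. finite B}"
    using assms by (intro nonneg_bdd_above_summable_on bdd_aboveI[of _ "exp (suminf g)"])
       (auto intro!: prod_nonneg sum_Pow_prod_le_exp)
  show "(\<Sum>\<^sub>\<infinity>B\<in>{B. finite B}. \<Prod>j\<in>B. g j) \<le> exp (suminf g)"
    by (rule infsum_le_finite_sums[OF s]) (use assms in \<open>auto intro!: sum_Pow_prod_le_exp\<close>)
qed

text \<open>Every finite family of finite sets of naturals lives in some \<open>{..<N}\<close>. A convergent unordered
  sum over finite sets is therefore a limit of finite products.\<close>

lemma filterlim_Pow_lessThan:
  "filterlim (\<lambda>N::nat. Pow {..<N}) (finite_subsets_at_top {B. finite B}) sequentially"
proof (rule filterlim_finite_subsets_at_top[THEN iffD2], intro allI impI)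
  fix X :: "nat set set"
  assume "finite X \<and> X \<subseteq> {B. finite B}"
  hence "finite (\<Union>X)" by auto
  then obtain K where K: "\<Union>X \<subseteq> {..<K}" using finite_nat_iff_bounded by auto
  show "\<forall>\<^sub>F N in sequentially. finite (Pow {..<N}) \<and> X \<subseteq> Pow {..<N} \<and> Pow {..<N} \<subseteq> {B. finite B}"
    using eventually_ge_at_top[of K]
  proof eventually_elim
    case (elim N)
    hence "{..<K} \<subseteq> {..<N}" by auto
    with K show ?case by (auto intro: finite_subset)
  qed
qed

text \<open>Expand the product: each finite set \<open>B\<close> records from which factors \<open>1 - a q^j\<close> the
  second summand is taken. For \<open>a = q^(n+1)\<close> these sets are the strict partitions with all parts
  beyond \<open>n\<close>.\<close>

lemma has_sum_qpoch:
  assumes "norm q < 1" "norm a < 1"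
  shows "((\<lambda>B. \<Prod>j\<in>B. - (a * q ^ j)) has_sum qpoch a q) {B. finite B}"
proof -
  have "summable (\<lambda>j. norm a * norm q ^ j)"
    using assms by (intro summable_mult summable_geometric) auto
  hence "(\<lambda>B. \<Prod>j\<in>B. norm a * norm q ^ j) summable_on {B. finite B}"
    by (intro summable_on_finite_sets_prod) auto
  hence "(\<lambda>B. \<Prod>j\<in>B. - (a * q ^ j)) summable_on {B. finite B}"
    by (intro abs_summable_summable[of "\<lambda>B. \<Prod>j\<in>B. - (a * q ^ j)"]) (simp only: norm_mult norm_power norm_minus_cancel flip: prod_norm)
  then obtain s where s: "((\<lambda>B. \<Prod>j\<in>B. - (a * q ^ j)) has_sum s) {B. finite B}"
    using summable_iff_has_sum_infsum by blast
  hence "(\<lambda>N. \<Sum>B\<in>Pow {..<N}. \<Prod>j\<in>B. - (a * q ^ j)) \<longlonglongrightarrow> s"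
    unfolding has_sum_def by (rule filterlim_compose[OF _ filterlim_Pow_lessThan])
  also have "(\<lambda>N. \<Sum>B\<in>Pow {..<N}. \<Prod>j\<in>B. - (a * q ^ j)) = (\<lambda>N. \<Prod>j<N. 1 - a * q ^ j)"
  proof
    fix N
    show "(\<Sum>B\<in>Pow {..<N}. \<Prod>j\<in>B. - (a * q ^ j)) = (\<Prod>j<N. 1 - a * q ^ j)"
      using prod_add[of "{..<N}" "\<lambda>j. - (a * q ^ j)" "\<lambda>_. 1"] by simp
  qed
  finally have "s = qpoch a q" using qpoch_LIMSEQ[OF assms] by (rule LIMSEQ_unique)
  thus ?thesis using s by simp
qed

text \<open>The strict partition with smallest part \<open>n\<close> whose other parts are \<open>n + 1 + j\<close> for \<open>j \<in> C\<close>. The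
  shift by \<open>n + 1\<close> lets \<open>C\<close> range over all finite sets, independently of \<open>n\<close>.\<close>

definition strict_partition_of :: "nat \<times> nat set \<Rightarrow> nat list" where
  "strict_partition_of = (\<lambda>(n, C). rev (sorted_list_of_set (insert n ((+) (Suc n) ` C))))"

lemma set_strict_partition_of:
  "finite C \<Longrightarrow> set (strict_partition_of (n, C)) = insert n ((+) (Suc n) ` C)"
  unfolding strict_partition_of_def prod.case set_rev by (rule set_sorted_list_of_set) simp

lemma last_strict_partition_of:
  assumes "finite C"
  shows "last (strict_partition_of (n, C)) = n"
proof -
  have "Min (insert n ((+) (Suc n) ` C)) = n"
    using assms by (intro Min_eqI) auto
  thus ?thesis
    unfolding strict_partition_of_def prod.case last_rev
    by (subst sorted_list_of_set_nonempty) (use assms in simp_all)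
qed

lemma last_le_partition:
  assumes "is_partition xs" "x \<in> set xs"
  shows "last xs \<le> x"
proof -
  have "xs \<noteq> []" using assms by auto
  then obtain ys where "xs = ys @ [last xs]" by (metis append_butlast_last_id)
  thus ?thesis using assms by (metis (no_types, lifting) is_partition_def sorted_wrt_append
      Un_iff set_append empty_iff insert_iff list.set order_refl)
qed

text \<open>Together with \<open>set_strict_partition_of\<close> and \<open>last_strict_partition_of\<close> this makes
  \<^const>\<open>strict_partition_of\<close> a bijection onto the nonempty strict partitions.\<close>

lemma strict_partition_of_last:
  assumes "is_partition xs" "distinct xs" "xs \<noteq> []"
  shows "strict_partition_of (last xs, {j. Suc (last xs) + j \<in> set xs}) = xs"
proof -
  have "set xs = insert (last xs) ((+) (Suc (last xs)) ` {j. Suc (last xs) + j \<in> set xs})"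
  proof (intro equalityI subsetI)
    fix x assume x: "x \<in> set xs"
    show "x \<in> insert (last xs) ((+) (Suc (last xs)) ` {j. Suc (last xs) + j \<in> set xs})"
    proof (cases "x = last xs")
      case False
      hence "x = Suc (last xs) + (x - Suc (last xs))" using last_le_partition[OF assms(1) x] by simp
      thus ?thesis using x by (intro insertI2 image_eqI[of _ _ "x - Suc (last xs)"]) auto
    qed simp
  qed (use assms in auto)
  moreover have "sorted (rev xs)" using assms(1) by (simp add: is_partition_def sorted_wrt_rev)
  hence "sorted_list_of_set (set (rev xs)) = rev xs" using assms(2)
    by (intro sorted_list_of_set.idem_if_sorted_distinct) auto
  ultimately show ?thesis by (simp add: strict_partition_of_def)
qed

lemma strict_partition_of_props:
  assumes "finite C" "n > 0"
  shows "is_partition (strict_partition_of (n, C))" "distinct (strict_partition_of (n, C))"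
    "strict_partition_of (n, C) \<noteq> []"
    "of_int (mu_partition_star (strict_partition_of (n, C))) * q ^ sum_list (strict_partition_of (n, C))
       = (q :: complex) ^ n * (\<Prod>j\<in>C. - (q ^ Suc n * q ^ j))"
proof -
  define A where "A = insert n ((+) (Suc n) ` C)"
  define xs where "xs = strict_partition_of (n, C)"
  have A: "finite A" using assms by (simp add: A_def)
  have xs: "xs = rev (sorted_list_of_set A)" by (simp add: xs_def strict_partition_of_def A_def)
  have set: "set xs = A" using A by (simp add: xs)
  have "sorted_wrt (\<ge>) xs" unfolding xs sorted_wrt_rev
    using sorted_sorted_list_of_set[of A] by simp
  moreover have "\<forall>x\<in>A. x > 0" using assms by (auto simp: A_def)
  ultimately show "is_partition (strict_partition_of (n, C))"
    by (simp add: is_partition_def set flip: xs_def)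
  have d: "distinct xs" using A by (simp add: xs)
  thus "distinct (strict_partition_of (n, C))" by (simp add: xs_def)
  show "strict_partition_of (n, C) \<noteq> []" using set unfolding xs_def[symmetric] A_def by auto
  have inj: "inj_on ((+) (Suc n)) C" by simp
  have nA: "n \<notin> (+) (Suc n) ` C" by auto
  have "length xs = card A" using distinct_card[OF d] by (simp add: set)
  also have "\<dots> = Suc (card ((+) (Suc n) ` C))"
    unfolding A_def using nA assms(1) by (intro card_insert_disjoint) auto
  finally have len: "length xs = Suc (card C)" by (simp only: card_image[OF inj])
  have "sum_list xs = \<Sum>A" using distinct_sum_list_conv_Sum[OF d] by (simp add: set)
  also have "\<dots> = n + \<Sum>((+) (Suc n) ` C)"
    unfolding A_def using nA assms(1) by (intro sum.insert) auto
  finally have sum: "sum_list xs = n + (\<Sum>j\<in>C. Suc n + j)" by (simp only: sum.reindex[OF inj] o_def)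
  have "(\<Prod>j\<in>C. - (q ^ Suc n * q ^ j)) = (\<Prod>j\<in>C. (-1) * q ^ (Suc n + j))"
    by (intro prod.cong) (simp_all add: power_add)
  also have "\<dots> = (-1) ^ card C * q ^ (\<Sum>j\<in>C. Suc n + j)"
    by (simp only: prod.distrib prod_constant power_sum)
  finally show "of_int (mu_partition_star (strict_partition_of (n, C))) * q ^ sum_list (strict_partition_of (n, C))
       = q ^ n * (\<Prod>j\<in>C. - (q ^ Suc n * q ^ j))"
    unfolding xs_def[symmetric] sum
    by (simp add: mu_partition_star_def mu_partition_def d len power_add)
qed

text \<open>The inner sums of absolute values are bounded by \<open>exp (1 / (1 - |q|))\<close> uniformly in \<open>n\<close>, and the
  outer sum is dominated by a geometric series.\<close>

lemma summable_smallest_part_expansion: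
  assumes "norm (q :: complex) < 1"
  shows "(\<lambda>(n, C). q ^ n * (\<Prod>j\<in>C. - (q ^ Suc n * q ^ j))) summable_on (SIGMA n:S. {C. finite C})"
proof -
  define r where "r = norm q"
  have r: "r \<ge> 0" "r < 1" using assms by (auto simp: r_def)
  define g where "g = (\<lambda>n. \<Sum>\<^sub>\<infinity>C\<in>{C. finite C}. \<Prod>j\<in>C. r ^ Suc n * r ^ j)"
  have s: "(\<lambda>j. r ^ Suc n * r ^ j) sums (r ^ Suc n * (1 / (1 - r)))" for n
    using r by (intro sums_mult geometric_sums) auto
  have nn: "r ^ Suc n * r ^ j \<ge> 0" for n j using r by simp
  have hs: "((\<lambda>C. r ^ n * (\<Prod>j\<in>C. r ^ Suc n * r ^ j)) has_sum (r ^ n * g n)) {C. finite C}" for n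
    unfolding g_def
    by (intro has_sum_cmult_right has_sum_infsum summable_on_finite_sets_prod nn sums_summable[OF s])
  have "g n \<le> exp (1 / (1 - r))" for n
  proof -
    have "g n \<le> exp (\<Sum>j. r ^ Suc n * r ^ j)"
      unfolding g_def by (intro infsum_finite_sets_prod_le nn sums_summable[OF s])
    also have "(\<Sum>j. r ^ Suc n * r ^ j) = r ^ Suc n * (1 / (1 - r))"
      using s by (simp only: sums_iff)
    also have "\<dots> \<le> 1 / (1 - r)" using r by (intro mult_left_le_one_le power_le_one) auto
    finally show ?thesis by simp
  qed
  hence le: "r ^ n * g n \<le> r ^ n * exp (1 / (1 - r))" for n
    using r by (intro mult_left_mono) auto
  have g0: "g n \<ge> 0" for n unfolding g_def using nn by (intro infsum_nonneg prod_nonneg) auto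
  have "summable (\<lambda>n. r ^ n * exp (1 / (1 - r)))"
    using r by (intro summable_mult2 summable_geometric) auto
  hence "summable (\<lambda>n. r ^ n * g n)"
    by (rule summable_comparison_test'[where N = 0]) (use le g0 r in simp)
  hence "(\<lambda>n. r ^ n * g n) summable_on UNIV"
    using g0 r by (intro summable_nonneg_imp_summable_on) auto
  hence "(\<lambda>n. r ^ n * g n) summable_on S" by (rule summable_on_subset) simp
  hence "(\<lambda>(n, C). r ^ n * (\<Prod>j\<in>C. r ^ Suc n * r ^ j)) summable_on (SIGMA n:S. {C. finite C})"
    by (intro summable_on_SigmaI[where g = "\<lambda>n. r ^ n * g n"])
       (use hs nn r in \<open>auto intro!: mult_nonneg_nonneg prod_nonneg simp del: power_Suc\<close>)
  also have "(\<lambda>(n, C). r ^ n * (\<Prod>j\<in>C. r ^ Suc n * r ^ j))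
      = (\<lambda>p. norm ((\<lambda>(n, C). q ^ n * (\<Prod>j\<in>C. - (q ^ Suc n * q ^ j))) p))"
    by (intro ext) (simp add: case_prod_beta r_def norm_mult norm_power flip: prod_norm)
  finally show ?thesis by (rule abs_summable_summable)
qed

lemma has_sum_F_series:
  assumes "norm q < 1" "0 \<notin> S"
  shows "((\<lambda>n. q ^ n * qpoch (q ^ Suc n) q) has_sum F_series S q) S"
proof -
  define f where "f = (\<lambda>(n, C). q ^ n * (\<Prod>j\<in>C. - (q ^ Suc n * q ^ j)))"
  define w where "w = (\<lambda>xs. of_int (mu_partition_star xs) * q ^ sum_list xs)"
  define Q where "Q = {xs \<in> partitions. xs \<noteq> [] \<and> last xs \<in> S \<and> distinct xs}"
  have "F_series S q = infsum w Q"
    unfolding F_series_def w_def Q_def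
    by (rule infsum_cong_neutral) (auto simp: mu_partition_star_def mu_partition_def)
  also have "infsum w Q = infsum f (SIGMA n:S. {C. finite C})"
  proof (rule infsum_reindex_bij_witness[where j = "\<lambda>xs. (last xs, {j. Suc (last xs) + j \<in> set xs})"
        and i = strict_partition_of])
    fix p assume "p \<in> (SIGMA n:S. {C :: nat set. finite C})"
    then obtain n C where p: "p = (n, C)" "n \<in> S" "finite C" by auto
    have n: "n > 0" using p assms(2) by (cases n) auto
    note * = strict_partition_of_props[OF p(3) n]
    show "strict_partition_of p \<in> Q"
      using * p by (simp add: Q_def partitions_def last_strict_partition_of)
    show "(last (strict_partition_of p), {j. Suc (last (strict_partition_of p)) + j \<in> set (strict_partition_of p)}) = p"
      using p by (auto simp: last_strict_partition_of set_strict_partition_of)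
  next
    fix xs assume xs: "xs \<in> Q"
    define C where "C = {j. Suc (last xs) + j \<in> set xs}"
    have "finite ((+) (Suc (last xs)) -` set xs)" by (intro finite_vimageI) auto
    hence fin: "finite C" by (simp add: C_def vimage_def)
    have eq: "strict_partition_of (last xs, C) = xs"
      using xs strict_partition_of_last by (simp add: Q_def partitions_def C_def)
    thus "strict_partition_of (last xs, {j. Suc (last xs) + j \<in> set xs}) = xs" by (simp add: C_def)
    show "(last xs, {j. Suc (last xs) + j \<in> set xs}) \<in> (SIGMA n:S. {C. finite C})"
      using fin xs by (simp add: Q_def C_def)
    have "last xs \<in> S" using xs by (simp add: Q_def)
    hence "last xs > 0" using assms(2) by (cases "last xs") auto
    hence "f (last xs, C) = w xs"
      using strict_partition_of_props(4)[OF fin, of "last xs" q] by (simp only: eq f_def w_def prod.case)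
    thus "f (last xs, {j. Suc (last xs) + j \<in> set xs}) = w xs" by (simp add: C_def)
  qed
  finally have F: "F_series S q = infsum f (SIGMA n:S. {C. finite C})" .
  have "f summable_on (SIGMA n:S. {C. finite C})"
    unfolding f_def by (rule summable_smallest_part_expansion[OF assms(1)])
  hence "(f has_sum F_series S q) (SIGMA n:S. {C. finite C})"
    unfolding F by (rule has_sum_infsum)
  thus ?thesis
  proof (rule has_sum_SigmaD)
    fix n
    have "norm (q ^ Suc n) < 1" using norm_mult_power_less_1[OF assms(1,1), of n] by simp
    hence "((\<lambda>C. \<Prod>j\<in>C. - (q ^ Suc n * q ^ j)) has_sum qpoch (q ^ Suc n) q) {C. finite C}"
      by (rule has_sum_qpoch[OF assms(1)])
    thus "((\<lambda>C. f (n, C)) has_sum q ^ n * qpoch (q ^ Suc n) q) {C. finite C}"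
      unfolding f_def prod.case by (rule has_sum_cmult_right)
  qed
qed

section \<open>Twisted sums and the q-binomial theorem\<close>

text \<open>Euler's case of the q-binomial theorem. The left-hand side \<open>h\<close> satisfies \<open>h(zq) = (1 - z) h(z)\<close>,
  while \<^term>\<open>qpoch z q\<close> satisfies the inverse recursion. Their product is thus unchanged under
  \<open>z \<mapsto> zq\<close>, hence equal to its limit \<open>h(0)\<close> along \<open>z q^N\<close>.\<close>

lemma sums_qpoch_quotient:
  assumes "norm q < 1" "norm z < 1"
  shows "(\<lambda>n. qpoch (q ^ Suc n) q * z ^ n) sums (qpoch q q / qpoch z q)"
proof -
  define c where "c = (\<lambda>n. qpoch (q ^ Suc n) q)"
  define h where "h = (\<lambda>z. \<Sum>n. c n * z ^ n)"
  have "c \<longlonglongrightarrow> 1" using qpoch_tendsto_1[OF assms(1,1)] by (simp add: c_def)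
  hence "Bseq c" by (intro convergent_imp_Bseq convergentI)
  then obtain K where K: "\<And>n. norm (c n) \<le> K" by (auto simp: Bseq_def)
  have summ: "summable (\<lambda>n. c n * z ^ n)" if "norm z < 1" for z
  proof (rule summable_comparison_test'[where N = 0])
    show "summable (\<lambda>n. K * norm z ^ n)" using that by (intro summable_mult summable_geometric) auto
    show "norm (c n * z ^ n) \<le> K * norm z ^ n" for n
      unfolding norm_mult norm_power by (intro mult_right_mono K) auto
  qed
  have c_Suc: "c n = (1 - q ^ Suc n) * c (Suc n)" for n
  proof -
    have "norm (q ^ Suc n) < 1" using norm_mult_power_less_1[OF assms(1,1), of n] by simp
    from qpoch_rec[OF assms(1) this] show ?thesis by (simp add: c_def mult.commute)
  qed
  have h_rec: "h (z * q) = (1 - z) * h z" if z: "norm z < 1" for z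
  proof -
    have zq: "norm (z * q) < 1" using norm_mult_power_less_1[OF assms(1) z, of 1] by simp
    have s: "summable (\<lambda>n. c n * z ^ n - c n * (z * q) ^ n)"
      by (intro summable_diff summ z zq)
    have "h z - h (z * q) = (\<Sum>n. c n * z ^ n - c n * (z * q) ^ n)"
      unfolding h_def by (rule suminf_diff[OF summ[OF z] summ[OF zq]])
    also have "\<dots> = (\<Sum>n. c (Suc n) * z ^ Suc n - c (Suc n) * (z * q) ^ Suc n)"
      using suminf_split_head[OF s] by simp
    also have "\<dots> = (\<Sum>n. z * (c n * z ^ n))"
    proof (intro suminf_cong)
      fix n
      show "c (Suc n) * z ^ Suc n - c (Suc n) * (z * q) ^ Suc n = z * (c n * z ^ n)"
        unfolding c_Suc[of n] by (simp add: algebra_simps power_mult_distrib)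
    qed
    also have "\<dots> = z * h z" unfolding h_def by (rule suminf_mult[OF summ[OF z]])
    finally show ?thesis by (simp add: algebra_simps)
  qed
  have inv: "h (z * q ^ N) * qpoch (z * q ^ N) q = h z * qpoch z q" for N
  proof (induction N)
    case (Suc N)
    note n = norm_mult_power_less_1[OF assms, of N]
    have "h (z * q ^ N * q) * qpoch (z * q ^ N * q) q = h (z * q ^ N) * qpoch (z * q ^ N) q"
      unfolding h_rec[OF n] qpoch_rec[OF assms(1) n] by simp
    with Suc show ?case by (simp add: mult_ac)
  qed simp
  have "isCont h 0" unfolding h_def
    by (rule isCont_powser[where K = "1 / 2"]) (auto intro!: summ simp: norm_divide)
  moreover have "(\<lambda>N. z * q ^ N) \<longlonglongrightarrow> 0"
    using assms by (intro tendsto_mult_right_zero LIMSEQ_power_zero)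
  ultimately have "(\<lambda>N. h (z * q ^ N)) \<longlonglongrightarrow> h 0" by (rule isCont_tendsto_compose)
  hence "(\<lambda>N. h (z * q ^ N) * qpoch (z * q ^ N) q) \<longlonglongrightarrow> h 0 * 1"
    by (intro tendsto_mult qpoch_tendsto_1 assms)
  hence "h z * qpoch z q = h 0" unfolding inv by (simp add: LIMSEQ_const_iff)
  moreover have "h 0 = qpoch q q" unfolding h_def powser_zero by (simp add: c_def)
  moreover have "qpoch z q \<noteq> 0" by (simp add: qpoch_def)
  ultimately have "h z = qpoch q q / qpoch z q" by (simp add: eq_divide_eq)
  moreover have "(\<lambda>n. c n * z ^ n) sums h z" unfolding h_def by (rule summable_sums[OF summ[OF assms(2)]])
  ultimately show ?thesis by (simp add: c_def)
qed

section \<open>Decay of the twisted sums at 1\<close>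

lemma stolz_region_mono: "C \<le> C' \<Longrightarrow> stolz_region C \<subseteq> stolz_region C'"
  by (auto simp: stolz_region_def intro: less_le_trans mult_right_mono)

lemma eventually_norm_less_1: "eventually (\<lambda>q. norm q < 1) (at 1 within stolz_region C)"
  by (auto simp: eventually_at_filter stolz_region_def)

lemma at_1_within_stolz_region_neq_bot:
  assumes "C > 1"
  shows "at 1 within stolz_region C \<noteq> bot"
proof -
  have "1 islimpt stolz_region C"
    unfolding islimpt_approachable
  proof (intro allI impI)
    fix e :: real assume "e > 0"
    define t where "t = min (e / 2) (1 / 2)"
    have t: "0 < t" "t < e" "t < 1" using \<open>e > 0\<close> by (auto simp: t_def)
    have "norm (complex_of_real (1 - t)) = 1 - t" using t by (simp only: norm_of_real)
    moreover have "1 - complex_of_real (1 - t) = of_real t" by simp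
    hence "norm (1 - complex_of_real (1 - t)) = t" using t by (simp only: norm_of_real)
    ultimately have "of_real (1 - t) \<in> stolz_region C" using t assms by (simp add: stolz_region_def)
    moreover have "dist (of_real (1 - t)) (1 :: complex) = t" using t by (simp add: dist_norm)
    ultimately show "\<exists>x'\<in>stolz_region C. x' \<noteq> 1 \<and> dist x' 1 < e" using t
      by (intro bexI[of _ "of_real (1 - t)"]) auto
  qed
  thus ?thesis by (simp add: trivial_limit_within)
qed

text \<open>The domination needed to take the limit \<open>q \<rightarrow> 1\<close> termwise: with \<open>r = |q|\<close>, the factor \<open>1 - r^m\<close>
  is at least \<open>m r^m (1 - r)\<close>, and \<open>|1 - q| \<le> C (1 - r)\<close> in the Stolz region.\<close>

lemma norm_lambert_term_le:
  assumes "q \<in> stolz_region C" "C > 0"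
  shows "norm ((1 - q) * (q ^ Suc m / (1 - q ^ Suc m))) \<le> C / real (Suc m)"
proof -
  define r where "r = norm q"
  have r: "0 \<le> r" "r < 1" "norm (1 - q) \<le> C * (1 - r)"
    using assms by (auto simp: stolz_region_def r_def)
  have "real (Suc m) * r ^ Suc m = (\<Sum>j<Suc m. r ^ Suc m)" by simp
  also have "\<dots> \<le> (\<Sum>j<Suc m. r ^ j)"
    using r by (intro sum_mono power_decreasing) auto
  finally have 1: "real (Suc m) * r ^ Suc m \<le> (\<Sum>j<Suc m. r ^ j)" .
  have "norm (1 - q) * r ^ Suc m * real (Suc m) = norm (1 - q) * (real (Suc m) * r ^ Suc m)"
    by (simp only: mult_ac)
  also have "\<dots> \<le> C * (1 - r) * (real (Suc m) * r ^ Suc m)"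
    using r by (intro mult_right_mono mult_nonneg_nonneg) auto
  also have "\<dots> \<le> C * (1 - r) * (\<Sum>j<Suc m. r ^ j)"
    using 1 r assms(2) by (intro mult_left_mono) auto
  also have "\<dots> = C * (1 - r ^ Suc m)" by (simp only: one_diff_power_eq mult.assoc)
  also have "\<dots> \<le> C * norm (1 - q ^ Suc m)"
    using norm_triangle_ineq2[of 1 "q ^ Suc m"] assms(2) unfolding norm_power
    by (intro mult_left_mono) (auto simp: r_def norm_mult norm_power)
  finally have "norm (1 - q) * r ^ Suc m * real (Suc m) \<le> C * norm (1 - q ^ Suc m)" .
  moreover have "norm (1 - q ^ Suc m) > 0"
    using norm_one_minus_power_ge[of q m] r by (auto simp: r_def)
  ultimately show ?thesis
    unfolding norm_mult norm_divide norm_power r_def[symmetric]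
    by (simp only: times_divide_eq_right divide_le_eq le_divide_eq of_nat_0_less_iff zero_less_Suc if_True times_divide_eq_left)
qed

lemma tendsto_lambert_term:
  "((\<lambda>q::complex. (1 - q) * (q ^ Suc m / (1 - q ^ Suc m))) \<longlongrightarrow> 1 / of_nat (Suc m)) (at 1 within S)"
proof -
  have "((\<lambda>q::complex. q ^ Suc m / (\<Sum>j<Suc m. q ^ j)) \<longlongrightarrow> 1 ^ Suc m / (\<Sum>j<Suc m. 1 ^ j)) (at 1 within S)"
    by (intro tendsto_intros) (simp del: of_nat_Suc sum.lessThan_Suc)
  hence "((\<lambda>q::complex. q ^ Suc m / (\<Sum>j<Suc m. q ^ j)) \<longlongrightarrow> 1 / of_nat (Suc m)) (at 1 within S)"
    by (simp del: of_nat_Suc sum.lessThan_Suc power_Suc)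
  moreover have "eventually (\<lambda>q::complex. q ^ Suc m / (\<Sum>j<Suc m. q ^ j)
      = (1 - q) * (q ^ Suc m / (1 - q ^ Suc m))) (at 1 within S)"
    using eventually_neq_at_within[of 1 1 S]
  proof eventually_elim
    case (elim q)
    thus ?case unfolding one_diff_power_eq by (simp del: power_Suc sum.lessThan_Suc)
  qed
  ultimately show ?thesis by (rule Lim_transform_eventually)
qed

text \<open>The value \<open>Li\<^sub>2(\<zeta>) - Li\<^sub>2(1)\<close> of the dilogarithm.\<close>

definition dilog_gap :: "complex \<Rightarrow> complex" where
  "dilog_gap \<zeta> = (\<Sum>m. (\<zeta> ^ Suc m - 1) / of_nat (Suc m) * (1 / of_nat (Suc m)))"

text \<open>Tannery's theorem, with the bound \<open>4 / m\<^sup>2\<close> for the \<open>m\<close>-th term in \<^term>\<open>stolz_region 2\<close>.\<close>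

lemma
  assumes "norm \<zeta> = 1"
  shows summable_dilog_gap: "summable (\<lambda>m. (\<zeta> ^ Suc m - 1) / of_nat (Suc m) * (1 / of_nat (Suc m)))"
    and tendsto_qlog_gap: "((\<lambda>q. (1 - q) * (qlog (\<zeta> * q) q - qlog q q)) \<longlongrightarrow> dilog_gap \<zeta>) (at 1 within stolz_region 2)"
proof -
  define a where "a = (\<lambda>m q. (\<zeta> ^ Suc m - 1) / of_nat (Suc m) * ((1 - q) * (q ^ Suc m / (1 - q ^ Suc m))))"
  define b where "b = (\<lambda>m. (\<zeta> ^ Suc m - 1) / of_nat (Suc m) * (1 / of_nat (Suc m)))"
  define M where "M = (\<lambda>m. 4 * inverse (real (Suc m) ^ 2))"
  have F: "at 1 within stolz_region 2 \<noteq> bot" by (rule at_1_within_stolz_region_neq_bot) simp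
  have lim: "(a m \<longlongrightarrow> b m) (at 1 within stolz_region 2)" for m
    unfolding a_def b_def by (intro tendsto_mult tendsto_const tendsto_lambert_term)
  have bound: "norm (a m q) \<le> M m" if "q \<in> stolz_region 2" for m q
  proof -
    have "norm (\<zeta> ^ Suc m - 1) \<le> 2"
      using norm_triangle_ineq4[of "\<zeta> ^ Suc m" 1] assms by (simp add: norm_power norm_mult)
    hence "norm (\<zeta> ^ Suc m - 1) / real (Suc m) \<le> 2 / real (Suc m)" by (intro divide_right_mono) auto
    hence "norm (a m q) \<le> 2 / real (Suc m) * (2 / real (Suc m))"
      unfolding a_def norm_mult[of "_ / _"] norm_divide[of _ "of_nat _"] norm_of_nat
      using norm_lambert_term_le[OF that] by (intro mult_mono) auto
    also have "\<dots> = M m" by (simp add: M_def power2_eq_square divide_inverse)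
    finally show ?thesis .
  qed
  have "eventually (\<lambda>q. q \<in> stolz_region 2) (at 1 within stolz_region 2)"
    by (simp add: eventually_at_filter)
  from eventually_prodI[OF eventually_True[of at_top] this]
  have ev: "eventually (\<lambda>(m, q). norm (a m q) \<le> M m) (at_top \<times>\<^sub>F (at 1 within stolz_region 2))"
    by (rule eventually_mono) (auto simp: bound)
  have M: "summable M" unfolding M_def
    by (intro summable_mult) (subst summable_Suc_iff, rule inverse_power_summable, simp)
  note tannery = tannerys_theorem[where a = a and b = b and M = M, OF lim ev M F]
  have *: "summable (\<lambda>m. norm (b m))"
    "((\<lambda>q. \<Sum>m. a m q) \<longlongrightarrow> suminf b) (at 1 within stolz_region 2)"
    using tannery by (rule conjunct2[THEN conjunct1], rule conjunct2[THEN conjunct2])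
  show "summable (\<lambda>m. (\<zeta> ^ Suc m - 1) / of_nat (Suc m) * (1 / of_nat (Suc m)))"
    using summable_norm_cancel[OF *(1)] by (simp only: b_def)
  have "eventually (\<lambda>q. (\<Sum>m. a m q) = (1 - q) * (qlog (\<zeta> * q) q - qlog q q)) (at 1 within stolz_region 2)"
    using eventually_norm_less_1
  proof eventually_elim
    case (elim q)
    have zq: "norm (\<zeta> * q) < 1" using elim assms by (simp add: norm_mult)
    have diff: "(\<zeta> * q) ^ Suc m / (of_nat (Suc m) * (1 - q ^ Suc m)) - q ^ Suc m / (of_nat (Suc m) * (1 - q ^ Suc m))
        = (\<zeta> ^ Suc m - 1) / of_nat (Suc m) * (q ^ Suc m / (1 - q ^ Suc m))" for m
      by (simp only: power_mult_distrib times_divide_times_eq left_diff_distrib diff_divide_distrib mult_1_left)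
    note s = summable_qlog[OF elim zq] summable_qlog[OF elim elim]
    have "qlog (\<zeta> * q) q - qlog q q =
        (\<Sum>m. (\<zeta> ^ Suc m - 1) / of_nat (Suc m) * (q ^ Suc m / (1 - q ^ Suc m)))"
      unfolding qlog_def suminf_diff[OF s] by (simp only: diff)
    moreover have "summable (\<lambda>m. (\<zeta> ^ Suc m - 1) / of_nat (Suc m) * (q ^ Suc m / (1 - q ^ Suc m)))"
      using summable_diff[OF s] by (simp only: diff)
    ultimately show ?case
      unfolding a_def by (simp only: mult.left_commute[of _ "1 - q"] suminf_mult)
  qed
  with *(2) have "((\<lambda>q. (1 - q) * (qlog (\<zeta> * q) q - qlog q q)) \<longlongrightarrow> suminf b) (at 1 within stolz_region 2)"
    by (rule Lim_transform_eventually)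
  thus "((\<lambda>q. (1 - q) * (qlog (\<zeta> * q) q - qlog q q)) \<longlongrightarrow> dilog_gap \<zeta>) (at 1 within stolz_region 2)"
    by (simp only: b_def dilog_gap_def)
qed

text \<open>Every term of the series has real part \<open>(Re (\<zeta>^m) - 1) / m\<^sup>2 \<le> 0\<close>, and the first one is strictly
  negative.\<close>

lemma Re_dilog_gap_neg:
  assumes "norm \<zeta> = 1" "\<zeta> \<noteq> 1"
  shows "Re (dilog_gap \<zeta>) < 0"
proof -
  define f where "f = (\<lambda>m. - Re ((\<zeta> ^ Suc m - 1) / of_nat (Suc m) * (1 / of_nat (Suc m))))"
  have "(\<lambda>m. (\<zeta> ^ Suc m - 1) / of_nat (Suc m) * (1 / of_nat (Suc m))) sums dilog_gap \<zeta>"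
    unfolding dilog_gap_def by (rule summable_sums[OF summable_dilog_gap[OF assms(1)]])
  hence f: "f sums (- Re (dilog_gap \<zeta>))" unfolding f_def by (intro sums_minus sums_Re)
  have Re_le: "Re (\<zeta> ^ n) \<le> 1" for n
    using complex_Re_le_cmod[of "\<zeta> ^ n"] assms by (simp add: norm_power)
  have "f m = (1 - Re (\<zeta> ^ Suc m)) / (real (Suc m) * real (Suc m))" for m
  proof -
    have "(\<zeta> ^ Suc m - 1) / of_nat (Suc m) * (1 / of_nat (Suc m))
        = (\<zeta> ^ Suc m - 1) / of_real (real (Suc m) * real (Suc m))"
      by (simp del: power_Suc of_nat_Suc)
    hence "f m = - (Re (\<zeta> ^ Suc m - 1) / (real (Suc m) * real (Suc m)))"
      unfolding f_def by (simp only: Re_divide_of_real)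
    thus ?thesis by (simp del: power_Suc of_nat_Suc add: minus_divide_left)
  qed
  hence nonneg: "f m \<ge> 0" for m using Re_le[of "Suc m"] by (simp del: power_Suc)
  have "Re \<zeta> \<noteq> 1"
  proof
    assume "Re \<zeta> = 1"
    with assms(1) have "Im \<zeta> = 0" by (simp add: cmod_def)
    with \<open>Re \<zeta> = 1\<close> assms(2) show False by (simp add: complex_eq_iff)
  qed
  hence "f 0 > 0" using Re_le[of 1] by (simp add: f_def)
  hence "0 < suminf f" using nonneg f by (intro suminf_pos2[of _ 0]) (auto simp: sums_iff)
  thus ?thesis using f by (simp add: sums_iff)
qed

text \<open>The choice of the Stolz region: as \<open>C\<close> decreases to \<open>1\<close> the opening angle closes, and the real part
  \<open>-A\<close> of \<^const>\<open>dilog_gap\<close> outweighs its imaginary part \<open>B\<close>.\<close>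

lemma narrow_angle:
  fixes A B :: real
  assumes "A > 0"
  obtains C where "1 < C" "C \<le> 2" "A / C - B * sqrt (1 - (1 / C)\<^sup>2) \<ge> A / 2"
proof -
  have "((\<lambda>C. A / C - B * sqrt (1 - (1 / C)\<^sup>2)) \<longlongrightarrow> A / 1 - B * sqrt (1 - (1 / 1)\<^sup>2)) (at_right 1)"
    by (intro tendsto_intros) auto
  hence "eventually (\<lambda>C. A / C - B * sqrt (1 - (1 / C)\<^sup>2) > A / 2) (at_right 1)"
    using assms by (intro order_tendstoD) auto
  moreover have "eventually (\<lambda>C::real. C \<in> {1<..<2}) (at_right 1)"
    by (rule eventually_at_right_real) simp
  ultimately have "eventually (\<lambda>C. 1 < C \<and> C \<le> 2 \<and> A / C - B * sqrt (1 - (1 / C)\<^sup>2) \<ge> A / 2) (at_right 1)"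
    by eventually_elim auto
  from eventually_happens'[OF trivial_limit_at_right_real this] that show ?thesis by blast
qed

lemma stolz_region_Re_Im:
  assumes "q \<in> stolz_region C" "C > 1"
  shows "norm (1 - q) / C \<le> Re (1 - q)" "\<bar>Im (1 - q)\<bar> \<le> sqrt (1 - (1 / C)\<^sup>2) * norm (1 - q)"
proof -
  have "norm (1 - q) / C \<le> 1 - norm q"
    using assms by (simp add: stolz_region_def divide_le_eq mult.commute)
  also have "\<dots> \<le> Re (1 - q)" using complex_Re_le_cmod[of q] by simp
  finally show 1: "norm (1 - q) / C \<le> Re (1 - q)" .
  have "(norm (1 - q) / C)\<^sup>2 \<le> (Re (1 - q))\<^sup>2" using 1 assms by (intro power_mono) auto
  hence "(Im (1 - q))\<^sup>2 \<le> (norm (1 - q))\<^sup>2 - (norm (1 - q) / C)\<^sup>2"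
    unfolding cmod_power2[of "1 - q"] by linarith
  also have "\<dots> = (1 - (1 / C)\<^sup>2) * (norm (1 - q))\<^sup>2"
    by (simp add: power_divide left_diff_distrib)
  finally have "sqrt ((Im (1 - q))\<^sup>2) \<le> sqrt ((1 - (1 / C)\<^sup>2) * (norm (1 - q))\<^sup>2)"
    by (rule real_sqrt_le_mono)
  thus "\<bar>Im (1 - q)\<bar> \<le> sqrt (1 - (1 / C)\<^sup>2) * norm (1 - q)"
    by (simp only: real_sqrt_mult real_sqrt_abs abs_norm_cancel)
qed

text \<open>The logarithm of the quotient is \<open>G / (1 - q)\<close> with \<open>G\<close> close to \<open>\<beta> = dilog_gap \<zeta>\<close>. In a region
  narrow enough for \<open>\<beta>\<close>, its real part is at most \<open>-A / (4 |1 - q|)\<close>, which tends to \<open>-\<infinity>\<close>.\<close>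

lemma qpoch_quotient_tendsto_0:
  assumes "norm \<zeta> = 1" "\<zeta> \<noteq> 1"
  shows "tendsto_at_1_in_disk (\<lambda>q. qpoch q q / qpoch (\<zeta> * q) q) 0"
proof -
  define \<beta> where "\<beta> = dilog_gap \<zeta>"
  define A where "A = - Re \<beta>"
  have A: "A > 0" using Re_dilog_gap_neg[OF assms] by (simp add: A_def \<beta>_def)
  obtain C where C: "1 < C" "C \<le> 2" "A / C - \<bar>Im \<beta>\<bar> * sqrt (1 - (1 / C)\<^sup>2) \<ge> A / 2"
    using narrow_angle[OF A] by blast
  define D where "D = (\<lambda>q. qlog (\<zeta> * q) q - qlog q q)"
  have "((\<lambda>q. (1 - q) * D q) \<longlongrightarrow> \<beta>) (at 1 within stolz_region C)"
    using tendsto_within_subset[OF tendsto_qlog_gap[OF assms(1)] stolz_region_mono[OF C(2)]]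
    by (simp add: D_def \<beta>_def)
  hence "eventually (\<lambda>q. dist ((1 - q) * D q) \<beta> < A / 4) (at 1 within stolz_region C)"
    by (rule tendstoD) (use A in auto)
  moreover have "eventually (\<lambda>q. q \<in> stolz_region C \<and> q \<noteq> 1) (at 1 within stolz_region C)"
    by (simp add: eventually_at_filter)
  ultimately have "eventually (\<lambda>q. norm (qpoch q q / qpoch (\<zeta> * q) q) \<le> 4 / A * norm (1 - q))
      (at 1 within stolz_region C)"
  proof eventually_elim
    case (elim q)
    define w where "w = 1 - q"
    define G where "G = w * D q"
    have w: "norm w > 0" "w \<noteq> 0" using elim by (auto simp: w_def)
    have w1: "norm w / C \<le> Re w" and w2: "\<bar>Im w\<bar> \<le> sqrt (1 - (1 / C)\<^sup>2) * norm w"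
      using stolz_region_Re_Im[of q C] elim C by (auto simp: w_def)
    have "Re ((G - \<beta>) * cnj w) \<le> norm ((G - \<beta>) * cnj w)" by (rule complex_Re_le_cmod)
    also have "\<dots> = norm (G - \<beta>) * norm w" by (simp add: norm_mult)
    also have "\<dots> \<le> A / 4 * norm w"
      using elim by (intro mult_right_mono) (auto simp: dist_norm G_def w_def)
    finally have 1: "Re ((G - \<beta>) * cnj w) \<le> A / 4 * norm w" .
    have "Im \<beta> * Im w \<le> \<bar>Im \<beta>\<bar> * \<bar>Im w\<bar>" by (metis abs_ge_self abs_mult)
    also have "\<dots> \<le> \<bar>Im \<beta>\<bar> * (sqrt (1 - (1 / C)\<^sup>2) * norm w)" using w2 by (intro mult_left_mono) auto
    finally have 2: "Im \<beta> * Im w \<le> \<bar>Im \<beta>\<bar> * sqrt (1 - (1 / C)\<^sup>2) * norm w" by (simp only: mult.assoc)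
    have 3: "A / C * norm w \<le> A * Re w" using mult_left_mono[OF w1, of A] A by simp
    have 4: "A / 2 * norm w \<le> (A / C - \<bar>Im \<beta>\<bar> * sqrt (1 - (1 / C)\<^sup>2)) * norm w"
      using C(3) by (intro mult_right_mono) auto
    \<comment> \<open>The main term contributes at most \<open>-A/2 |w|\<close> by the choice of \<open>C\<close>, and the error term at most \<open>A/4 |w|\<close>.\<close>
    have "Re (G * cnj w) = Re ((G - \<beta>) * cnj w) + (- A * Re w + Im \<beta> * Im w)"
      by (simp add: A_def algebra_simps)
    also have "\<dots> \<le> - (A / 4) * norm w"
      using 1 2 3 4 by (simp add: left_diff_distrib)
    finally have "Re (G * cnj w) \<le> - (A / 4) * norm w" .
    hence "Re (G * cnj w) / (norm w)\<^sup>2 \<le> - (A / 4) * norm w / (norm w)\<^sup>2"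
      by (intro divide_right_mono) auto
    also have "\<dots> = - (A / (4 * norm w))" using w by (simp add: power2_eq_square)
    also have "Re (G * cnj w) / (norm w)\<^sup>2 = Re (D q)"
    proof -
      have "G * cnj w = D q * (w * cnj w)" by (simp add: G_def mult_ac)
      also have "\<dots> = D q * of_real ((norm w)\<^sup>2)" by (simp only: complex_norm_square)
      finally have "Re (G * cnj w) = Re (D q) * (norm w)\<^sup>2" by simp
      thus ?thesis using w by simp
    qed
    finally have le: "Re (D q) \<le> - (A / (4 * norm w))" .
    have x: "A / (4 * norm w) > 0" using A w by simp
    have "norm (qpoch q q / qpoch (\<zeta> * q) q) = exp (Re (D q))"
      by (simp add: qpoch_def D_def norm_exp_eq_Re algebra_simps flip: exp_diff norm_divide)
    also have "\<dots> \<le> exp (- (A / (4 * norm w)))" using le by simp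
    also have "\<dots> = inverse (exp (A / (4 * norm w)))" by (rule exp_minus)
    also have "\<dots> \<le> inverse (A / (4 * norm w))"
      using x exp_ge_add_one_self[of "A / (4 * norm w)"] by (intro le_imp_inverse_le) linarith+
    also have "\<dots> = 4 / A * norm (1 - q)" by (simp add: w_def)
    finally show ?case .
  qed
  moreover have "((\<lambda>q::complex. 4 / A * norm (1 - q)) \<longlongrightarrow> 4 / A * norm (1 - 1 :: complex)) (at 1 within stolz_region C)"
    by (intro tendsto_intros)
  hence "((\<lambda>q::complex. 4 / A * norm (1 - q)) \<longlongrightarrow> 0) (at 1 within stolz_region C)" by simp
  ultimately have "((\<lambda>q. qpoch q q / qpoch (\<zeta> * q) q) \<longlongrightarrow> 0) (at 1 within stolz_region C)"
    by (rule Lim_null_comparison)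
  thus ?thesis unfolding tendsto_at_1_in_disk_def using C(1) by blast
qed

lemma tendsto_at_1_in_disk_const: "tendsto_at_1_in_disk (\<lambda>_. c) c"
  unfolding tendsto_at_1_in_disk_def by (intro exI[of _ 2]) auto

lemma tendsto_at_1_in_disk_cong:
  assumes "tendsto_at_1_in_disk f L" "\<And>q. norm q < 1 \<Longrightarrow> f q = g q"
  shows "tendsto_at_1_in_disk g L"
proof -
  obtain C where C: "C > 1" "(f \<longlongrightarrow> L) (at 1 within stolz_region C)"
    using assms(1) by (auto simp: tendsto_at_1_in_disk_def)
  have "eventually (\<lambda>q. f q = g q) (at 1 within stolz_region C)"
    using eventually_norm_less_1 by eventually_elim (rule assms(2))
  from Lim_transform_eventually[OF C(2) this] C(1) show ?thesis
    by (auto simp: tendsto_at_1_in_disk_def)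
qed

lemma tendsto_at_1_in_disk_cmult:
  "tendsto_at_1_in_disk f L \<Longrightarrow> tendsto_at_1_in_disk (\<lambda>q. c * f q) (c * L)"
  unfolding tendsto_at_1_in_disk_def by (blast intro: tendsto_mult_left)

text \<open>The two limits may come with different opening angles; both hold in the narrower region.\<close>

lemma tendsto_at_1_in_disk_add:
  assumes "tendsto_at_1_in_disk f L" "tendsto_at_1_in_disk g M"
  shows "tendsto_at_1_in_disk (\<lambda>q. f q + g q) (L + M)"
proof -
  obtain C C' where C: "C > 1" "(f \<longlongrightarrow> L) (at 1 within stolz_region C)"
      "C' > 1" "(g \<longlongrightarrow> M) (at 1 within stolz_region C')"
    using assms by (auto simp: tendsto_at_1_in_disk_def)
  have "((\<lambda>q. f q + g q) \<longlongrightarrow> L + M) (at 1 within stolz_region (min C C'))"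
    by (intro tendsto_add tendsto_within_subset[OF C(2)] tendsto_within_subset[OF C(4)] stolz_region_mono) auto
  with C show ?thesis unfolding tendsto_at_1_in_disk_def by (intro exI[of _ "min C C'"]) auto
qed

lemma tendsto_at_1_in_disk_sum:
  "(\<And>i. i \<in> I \<Longrightarrow> tendsto_at_1_in_disk (f i) (L i)) \<Longrightarrow>
    tendsto_at_1_in_disk (\<lambda>q. \<Sum>i\<in>I. f i q) (\<Sum>i\<in>I. L i)"
  by (induction I rule: infinite_finite_induct)
     (auto intro: tendsto_at_1_in_disk_const tendsto_at_1_in_disk_add)

section \<open>Smallest parts divisible by a fixed integer\<close>

lemma sum_root_of_unity_powers:
  fixes m n :: nat
  assumes "m > 0"
  defines "\<omega> \<equiv> exp (2 * of_real pi * \<i> * of_nat 1 / of_nat m) :: complex"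
  shows "(\<Sum>r<m. (\<omega> ^ r) ^ n) = (if m dvd n then of_nat m else 0)"
    and "r < m \<Longrightarrow> \<omega> ^ r = 1 \<longleftrightarrow> r = 0" and "norm (\<omega> ^ r) = 1"
proof -
  have pow: "\<omega> ^ j = exp (2 * of_real pi * \<i> * of_nat j / of_nat m)" for j
    unfolding \<omega>_def exp_of_nat_mult[symmetric] by (simp add: mult_ac)
  have eq_1: "\<omega> ^ j = 1 \<longleftrightarrow> m dvd j" for j
    unfolding pow using complex_root_unity_eq_1[of m j] assms(1) by simp
  show "r < m \<Longrightarrow> \<omega> ^ r = 1 \<longleftrightarrow> r = 0" unfolding eq_1 by (auto dest: dvd_imp_le)
  show "norm (\<omega> ^ r) = 1" unfolding pow norm_exp_eq_Re by simp
  have "(\<Sum>r<m. (\<omega> ^ r) ^ n) = (\<Sum>r<m. (\<omega> ^ n) ^ r)" by (simp add: mult.commute flip: power_mult)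
  also have "\<dots> = (if m dvd n then of_nat m else 0)"
  proof (cases "m dvd n")
    case True
    hence "\<omega> ^ n = 1" by (simp add: eq_1)
    thus ?thesis using True by simp
  next
    case False
    have "(\<omega> ^ n) ^ m = 1" unfolding power_mult[symmetric] eq_1 by simp
    hence "(1 - \<omega> ^ n) * (\<Sum>r<m. (\<omega> ^ n) ^ r) = 0" by (simp flip: one_diff_power_eq)
    thus ?thesis using False eq_1[of n] by simp
  qed
  finally show "(\<Sum>r<m. (\<omega> ^ r) ^ n) = (if m dvd n then of_nat m else 0)" .
qed

text \<open>Averaging the twisted sums over the \<open>m\<close>-th roots of unity selects the multiples of \<open>m\<close>, and only
  the trivial character survives in the limit. The index \<open>n = 0\<close> is included: it drops out later
  because \<open>0\<close> is not power-free.\<close>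

lemma smallest_part_multiples:
  fixes m :: nat
  assumes "m > 0"
  obtains M where "tendsto_at_1_in_disk M (1 / of_nat m)"
    "\<And>q. norm q < 1 \<Longrightarrow> (\<lambda>n. if m dvd n then q ^ n * qpoch (q ^ Suc n) q else 0) sums M q"
proof -
  define \<omega> where "\<omega> = (exp (2 * of_real pi * \<i> * of_nat 1 / of_nat m) :: complex)"
  note \<omega> = sum_root_of_unity_powers[OF assms, folded \<omega>_def]
  define M where "M = (\<lambda>q. 1 / of_nat m * (\<Sum>r<m. qpoch q q / qpoch (\<omega> ^ r * q) q))"
  have "tendsto_at_1_in_disk (\<lambda>q. qpoch q q / qpoch (\<omega> ^ r * q) q) (if r = 0 then 1 else 0)"
    if "r < m" for r
  proof (cases "r = 0")
    case True
    thus ?thesis using tendsto_at_1_in_disk_const[of 1] by (simp add: qpoch_def)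
  next
    case False
    thus ?thesis using qpoch_quotient_tendsto_0[of "\<omega> ^ r"] \<omega>(2,3)[of r] that by simp
  qed
  hence "tendsto_at_1_in_disk M (1 / of_nat m * (\<Sum>r<m. if r = 0 then 1 else 0))"
    unfolding M_def by (intro tendsto_at_1_in_disk_cmult tendsto_at_1_in_disk_sum) auto
  hence "tendsto_at_1_in_disk M (1 / of_nat m)" using assms by simp
  moreover have "(\<lambda>n. if m dvd n then q ^ n * qpoch (q ^ Suc n) q else 0) sums M q"
    if q: "norm q < 1" for q
  proof -
    have "(\<lambda>n. 1 / of_nat m * (\<Sum>r<m. qpoch (q ^ Suc n) q * (\<omega> ^ r * q) ^ n)) sums M q"
      unfolding M_def
      by (intro sums_mult sums_sum sums_qpoch_quotient) (use q \<omega>(3) in \<open>auto simp: norm_mult\<close>)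
    moreover have "1 / of_nat m * (\<Sum>r<m. qpoch (q ^ Suc n) q * (\<omega> ^ r * q) ^ n)
      = (if m dvd n then q ^ n * qpoch (q ^ Suc n) q else 0)" for n
    proof -
      have "(\<Sum>r<m. qpoch (q ^ Suc n) q * (\<omega> ^ r * q) ^ n)
          = q ^ n * qpoch (q ^ Suc n) q * (\<Sum>r<m. (\<omega> ^ r) ^ n)"
        unfolding sum_distrib_left by (intro sum.cong) (simp_all only: power_mult_distrib mult_ac)
      thus ?thesis unfolding \<omega>(1) using assms by simp
    qed
    ultimately show ?thesis by simp
  qed
  ultimately show ?thesis using that by blast
qed

section \<open>Power-free smallest parts\<close>

lemma prime_power_prod_dvd_iff:
  fixes n :: nat
  assumes "finite A" "\<And>p. p \<in> A \<Longrightarrow> prime p"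
  shows "(\<Prod>p\<in>A. p ^ k) dvd n \<longleftrightarrow> (\<forall>p\<in>A. p ^ k dvd n)"
  using assms
proof (induction A rule: finite_induct)
  case (insert p A)
  have "coprime (p ^ k) (\<Prod>r\<in>A. r ^ k)"
    using insert by (intro prod_coprime_right) (auto intro!: coprime_power_left_iff[THEN iffD2] coprime_power_right_iff[THEN iffD2] primes_coprime)
  hence "p ^ k * (\<Prod>r\<in>A. r ^ k) dvd n \<longleftrightarrow> p ^ k dvd n \<and> (\<Prod>r\<in>A. r ^ k) dvd n"
    by (meson divides_mult dvd_mult_left dvd_mult_right)
  thus ?case using insert by simp
qed simp

text \<open>Expand \<open>\<Prod>p\<le>N. 1 - [p^k dvd n]\<close>. For \<open>n = 0\<close> both sides vanish because \<open>N \<ge> 2\<close> provides at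
  least one prime.\<close>

lemma S_fr_indicator:
  assumes "N \<ge> 2" "k > 0"
  defines "P \<equiv> {p :: nat. prime p \<and> p \<le> N}"
  shows "(if n \<in> S_fr k N then 1 else 0 :: 'a :: comm_ring_1)
    = (\<Sum>A\<in>Pow P. (-1) ^ card A * (if (\<Prod>p\<in>A. p ^ k) dvd n then 1 else 0))"
proof -
  have fin: "finite P" unfolding P_def by simp
  have "2 \<in> P" using assms(1) by (simp add: P_def)
  hence "(if n \<in> S_fr k N then 1 else 0 :: 'a) = (if \<exists>p\<in>P. p ^ k dvd n then 0 else 1)"
    using assms by (cases "n = 0") (auto simp: S_fr_def P_def intro: exI[of _ 2])
  also have "\<dots> = (\<Prod>p\<in>P. (if p ^ k dvd n then -1 else 0) + 1)"
  proof (cases "\<exists>p\<in>P. p ^ k dvd n")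
    case True
    hence "\<exists>p\<in>P. (if p ^ k dvd n then -1 else 0 :: 'a) + 1 = 0" by auto
    from prod_zero[OF fin this] show ?thesis using True by simp
  next
    case False
    hence "(\<Prod>p\<in>P. (if p ^ k dvd n then -1 else 0 :: 'a) + 1) = 1" by (intro prod.neutral) auto
    thus ?thesis using False by simp
  qed
  also have "\<dots> = (\<Sum>A\<in>Pow P. \<Prod>p\<in>A. if p ^ k dvd n then -1 else 0)"
    by (simp add: prod_add[OF fin])
  also have "\<dots> = (\<Sum>A\<in>Pow P. (-1) ^ card A * (if (\<Prod>p\<in>A. p ^ k) dvd n then 1 else 0))"
  proof (intro sum.cong refl)
    fix A assume "A \<in> Pow P"
    hence A: "finite A" "\<And>p. p \<in> A \<Longrightarrow> prime p" using fin by (auto simp: P_def intro: finite_subset)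
    show "(\<Prod>p\<in>A. if p ^ k dvd n then -1 else 0 :: 'a)
        = (-1) ^ card A * (if (\<Prod>p\<in>A. p ^ k) dvd n then 1 else 0)"
    proof (cases "\<forall>p\<in>A. p ^ k dvd n")
      case True
      hence "(\<Prod>p\<in>A. if p ^ k dvd n then -1 else 0 :: 'a) = (\<Prod>p\<in>A. -1)" by (intro prod.cong) auto
      thus ?thesis using prime_power_prod_dvd_iff[OF A, of k n] True by simp
    next
      case False
      hence "\<exists>p\<in>A. (if p ^ k dvd n then -1 else 0 :: 'a) = 0" by auto
      from prod_zero[OF A(1) this] show ?thesis
        using prime_power_prod_dvd_iff[OF A, of k n] False by simp
    qed
  qed
  finally show ?thesis .
qed

lemma F_series_S_fr_limit:
  assumes "N \<ge> 2" "k > 0"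
  shows "tendsto_at_1_in_disk (F_series (S_fr k N)) (\<Prod>p | prime p \<and> p \<le> N. 1 - 1 / of_nat p ^ k)"
proof -
  define P where "P = {p :: nat. prime p \<and> p \<le> N}"
  have fin: "finite P" unfolding P_def by simp
  define d where "d = (\<lambda>A :: nat set. \<Prod>p\<in>A. p ^ k)"
  have "d A > 0" if "A \<in> Pow P" for A
    using that by (auto simp: d_def P_def prime_gt_0_nat intro!: prod_pos)
  hence "\<exists>M. tendsto_at_1_in_disk M (1 / of_nat (d A)) \<and>
      (\<forall>q. norm q < 1 \<longrightarrow> (\<lambda>n. if d A dvd n then q ^ n * qpoch (q ^ Suc n) q else 0) sums M q)"
    if "A \<in> Pow P" for A
    using smallest_part_multiples[of "d A"] that by metis
  then obtain M where M: "\<And>A. A \<in> Pow P \<Longrightarrow> tendsto_at_1_in_disk (M A) (1 / of_nat (d A))"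
    "\<And>A q. A \<in> Pow P \<Longrightarrow> norm q < 1 \<Longrightarrow>
       (\<lambda>n. if d A dvd n then q ^ n * qpoch (q ^ Suc n) q else 0) sums M A q"
    by metis
  have "tendsto_at_1_in_disk (\<lambda>q. \<Sum>A\<in>Pow P. (-1) ^ card A * M A q)
      (\<Sum>A\<in>Pow P. (-1) ^ card A * (1 / of_nat (d A)))"
    by (intro tendsto_at_1_in_disk_sum tendsto_at_1_in_disk_cmult M)
  also have "(\<Sum>A\<in>Pow P. (-1) ^ card A * (1 / of_nat (d A))) = (\<Prod>p\<in>P. - 1 / of_nat p ^ k + 1 :: complex)"
    unfolding prod_add[OF fin]
    by (intro sum.cong) (simp_all add: d_def prod_dividef prod_uminus prod_power_distrib of_nat_prod)
  also have "\<dots> = (\<Prod>p\<in>P. 1 - 1 / of_nat p ^ k)" by simp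
  finally have "tendsto_at_1_in_disk (\<lambda>q. \<Sum>A\<in>Pow P. (-1) ^ card A * M A q) (\<Prod>p\<in>P. 1 - 1 / of_nat p ^ k)" .
  hence "tendsto_at_1_in_disk (F_series (S_fr k N)) (\<Prod>p\<in>P. 1 - 1 / of_nat p ^ k)"
  proof (rule tendsto_at_1_in_disk_cong)
    fix q :: complex assume q: "norm q < 1"
    define c where "c = (\<lambda>n. q ^ n * qpoch (q ^ Suc n) q)"
    have "(c has_sum F_series (S_fr k N) q) (S_fr k N)"
      unfolding c_def by (rule has_sum_F_series[OF q]) (simp add: S_fr_def)
    also have "?this \<longleftrightarrow> ((\<lambda>n. (if n \<in> S_fr k N then 1 else 0) * c n) has_sum F_series (S_fr k N) q) UNIV"
      by (intro has_sum_cong_neutral) auto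
    finally have "(\<lambda>n. (if n \<in> S_fr k N then 1 else 0) * c n) sums F_series (S_fr k N) q"
      by (rule has_sum_imp_sums)
    moreover have "(\<lambda>n. \<Sum>A\<in>Pow P. (-1) ^ card A * (if d A dvd n then c n else 0)) sums
        (\<Sum>A\<in>Pow P. (-1) ^ card A * M A q)"
      unfolding c_def by (intro sums_sum sums_mult M q)
    moreover have "(\<Sum>A\<in>Pow P. (-1) ^ card A * (if d A dvd n then c n else 0))
        = (if n \<in> S_fr k N then 1 else 0) * c n" for n
      unfolding S_fr_indicator[OF assms] sum_distrib_right d_def P_def
      by (intro sum.cong) auto
    ultimately show "(\<Sum>A\<in>Pow P. (-1) ^ card A * M A q) = F_series (S_fr k N) q"
      using sums_unique2 by (simp only:) blast
  qed
  thus ?thesis by (simp add: P_def)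
qed

section \<open>The Euler product\<close>

lemma inverse_power_summable_on:
  assumes "k \<ge> 2"
  shows "(\<lambda>n. 1 / real n ^ k) summable_on A"
proof -
  have "(\<lambda>n. 1 / real n ^ k) summable_on UNIV"
    using inverse_power_summable[OF assms, where 'a = real]
    by (intro summable_nonneg_imp_summable_on) (simp_all add: divide_inverse)
  thus ?thesis by (rule summable_on_subset) simp
qed

lemma has_sum_zeta:
  assumes "k \<ge> 2"
  shows "((\<lambda>n. 1 / of_nat n ^ k) has_sum zeta (of_nat k)) {1..}"
proof -
  have s: "summable (\<lambda>n. norm (1 / of_nat n ^ k :: complex))"
    using inverse_power_summable[OF assms, where 'a = real]
    by (simp add: norm_inverse norm_power divide_inverse)
  have "(\<lambda>n. 1 / of_nat (Suc n) powr of_nat k) = (\<lambda>n. 1 / of_nat (Suc n) ^ k :: complex)"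
    by (intro ext) (subst powr_nat', use assms in auto)
  hence z: "zeta (of_nat k) = (\<Sum>n. 1 / of_nat (Suc n) ^ k)" by (simp only: zeta_def)
  have "(\<Sum>n. 1 / of_nat n ^ k :: complex) = zeta (of_nat k)"
    using suminf_split_head[OF summable_norm_cancel[OF s]] assms unfolding z by simp
  hence "((\<lambda>n. 1 / of_nat n ^ k) has_sum zeta (of_nat k)) UNIV"
    using norm_summable_imp_has_sum[OF s] summable_sums[OF summable_norm_cancel[OF s]] by simp
  also have "?this \<longleftrightarrow> ((\<lambda>n. 1 / of_nat n ^ k) has_sum zeta (of_nat k)) {1..}"
    using assms by (intro has_sum_cong_neutral) (auto simp: not_le)
  finally show ?thesis .
qed

text \<open>Sieving: among the integers free of primes in \<open>A\<close>, the multiples of a further prime \<open>p\<close> are exactly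
  \<open>p\<close> times such integers, so they carry the fraction \<open>p^(-k)\<close> of the sum.\<close>

lemma has_sum_coprime_zeta:
  assumes "k \<ge> 2" "finite A" "\<And>p. p \<in> A \<Longrightarrow> prime p"
  shows "((\<lambda>n. 1 / of_nat n ^ k) has_sum (zeta (of_nat k) * (\<Prod>p\<in>A. 1 - 1 / of_nat p ^ k)))
           {n\<in>{1..}. \<forall>p\<in>A. \<not> p dvd n}"
  using assms(2,3)
proof (induction A rule: finite_induct)
  case empty
  thus ?case using has_sum_zeta[OF assms(1)] by (simp add: atLeast_def)
next
  case (insert p A)
  define f :: "nat \<Rightarrow> complex" where "f = (\<lambda>n. 1 / of_nat n ^ k)"
  define X where "X = {n\<in>{1..}. \<forall>p\<in>A. \<not> p dvd n}"
  define s where "s = zeta (of_nat k) * (\<Prod>p\<in>A. 1 - 1 / of_nat p ^ k :: complex)"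
  have p: "prime p" "p > 0" using insert by (auto simp: prime_gt_0_nat)
  have X: "(f has_sum s) X" using insert unfolding f_def X_def s_def by simp
  have dvd: "r dvd p * n \<longleftrightarrow> r dvd n" if "r \<in> A" for r n
  proof -
    have "prime r" "r \<noteq> p" using that insert by auto
    hence "\<not> r dvd p" using primes_dvd_imp_eq p(1) by blast
    thus ?thesis using \<open>prime r\<close> by (simp add: prime_dvd_mult_iff)
  qed
  have "((\<lambda>n. 1 / of_nat p ^ k * f n) has_sum (1 / of_nat p ^ k * s)) X"
    by (intro has_sum_cmult_right X)
  also have "(\<lambda>n. 1 / of_nat p ^ k * f n) = f \<circ> (*) p"
    by (auto simp: f_def power_mult_distrib)
  finally have "(f has_sum (1 / of_nat p ^ k * s)) ((*) p ` X)"
    using p(2) by (subst has_sum_reindex) (auto simp: inj_on_def o_def)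
  hence "(f has_sum (s - 1 / of_nat p ^ k * s)) (X - (*) p ` X)"
    using p(2) dvd by (intro has_sum_Diff X) (auto simp: X_def)
  also have "X - (*) p ` X = {n\<in>{1..}. \<forall>r\<in>insert p A. \<not> r dvd n}"
  proof (intro equalityI subsetI)
    fix n assume n: "n \<in> X - (*) p ` X"
    have "\<not> p dvd n"
    proof
      assume "p dvd n"
      then obtain m where m: "n = p * m" by (elim dvdE)
      hence "m \<in> X" using n dvd by (cases "m = 0") (auto simp: X_def)
      thus False using n m by auto
    qed
    thus "n \<in> {n\<in>{1..}. \<forall>r\<in>insert p A. \<not> r dvd n}" using n by (auto simp: X_def)
  qed (auto simp: X_def)
  also have "s - 1 / of_nat p ^ k * s = zeta (of_nat k) * (\<Prod>p\<in>insert p A. 1 - 1 / of_nat p ^ k)"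
    using insert by (simp add: s_def algebra_simps)
  finally show ?case by (simp only: f_def)
qed

text \<open>An integer beyond \<open>1\<close> without prime factor up to \<open>N\<close> exceeds \<open>N\<close>, so the sieved sum differs from its
  term at \<open>1\<close> by at most a tail of the series.\<close>

lemma euler_product_zeta:
  assumes "k \<ge> 2"
  shows "(\<lambda>N. zeta (of_nat k) * (\<Prod>p | prime p \<and> p \<le> N. 1 - 1 / of_nat p ^ k)) \<longlonglongrightarrow> 1"
proof -
  define f :: "nat \<Rightarrow> complex" where "f = (\<lambda>n. 1 / of_nat n ^ k)"
  define g where "g = (\<lambda>n. 1 / real n ^ k)"
  have g: "g summable_on A" for A unfolding g_def by (rule inverse_power_summable_on[OF assms])
  define E where "E = (\<lambda>N. zeta (of_nat k) * (\<Prod>p | prime p \<and> p \<le> N. 1 - 1 / of_nat p ^ k :: complex))"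
  have bound: "norm (E N - 1) \<le> infsum g {Suc N..}" for N
  proof -
    define X where "X = {n\<in>{1..}. \<forall>p\<in>{p. prime p \<and> p \<le> N}. \<not> p dvd n}"
    have "(f has_sum E N) X"
      unfolding f_def E_def X_def by (rule has_sum_coprime_zeta[OF assms]) auto
    moreover have "(f has_sum 1) {1}" by (intro has_sum_finiteI) (auto simp: f_def)
    moreover have "{1} \<subseteq> X" by (auto simp: X_def)
    ultimately have "(f has_sum (E N - 1)) (X - {1})" by (intro has_sum_Diff)
    moreover have "X - {1} \<subseteq> {Suc N..}"
    proof
      fix n assume n: "n \<in> X - {1}"
      then obtain p where p: "prime p" "p dvd n" using prime_factor_nat[of n] by (auto simp: X_def)
      hence "p > N" using n by (auto simp: X_def not_le)
      moreover have "p \<le> n" using p n by (intro dvd_imp_le) (auto simp: X_def)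
      ultimately show "n \<in> {Suc N..}" by simp
    qed
    moreover have "infsum g (X - {1}) \<le> infsum g {Suc N..}"
      using \<open>X - {1} \<subseteq> _\<close> by (intro infsum_mono2 g) (auto simp: g_def)
    moreover have "((\<lambda>n. norm (f n)) has_sum infsum g (X - {1})) (X - {1})"
      using has_sum_infsum[OF g] by (simp add: f_def g_def norm_divide norm_power)
    hence "norm (E N - 1) \<le> infsum g (X - {1})"
      by (rule norm_has_sum_bound) (rule \<open>(f has_sum (E N - 1)) (X - {1})\<close>)
    ultimately show ?thesis by linarith
  qed
  have "summable g" using inverse_power_summable[OF assms, where 'a = real] by (simp add: g_def divide_inverse)
  have tail: "infsum g {Suc N..} = (\<Sum>n. g (n + Suc N))" for N
  proof -
    have "infsum g {Suc N..} = infsum (\<lambda>n. g (n + Suc N)) UNIV"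
      by (rule infsum_reindex_bij_witness[of _ "\<lambda>n. n + Suc N" "\<lambda>n. n - Suc N"]) auto
    also have "\<dots> = (\<Sum>n. g (n + Suc N))"
    proof (intro infsumI norm_summable_imp_has_sum summable_sums)
      show "summable (\<lambda>n. g (n + Suc N))" by (rule summable_ignore_initial_segment[OF \<open>summable g\<close>])
      moreover have "g n \<ge> 0" for n by (simp add: g_def)
      ultimately show "summable (\<lambda>n. norm (g (n + Suc N)))" by simp
    qed
    finally show ?thesis .
  qed
  have "(\<lambda>N. \<Sum>n. g (n + Suc N)) \<longlonglongrightarrow> 0"
    by (rule LIMSEQ_Suc[OF suminf_exist_split2[OF \<open>summable g\<close>]])
  hence "(\<lambda>N. infsum g {Suc N..}) \<longlonglongrightarrow> 0" unfolding tail .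
  hence "(\<lambda>N. E N - 1) \<longlonglongrightarrow> 0"
    by (rule Lim_null_comparison[OF always_eventually, rotated]) (use bound in blast)
  thus ?thesis unfolding E_def by (simp add: LIM_zero_iff)
qed

section \<open>Zeta values at even integers\<close>

text \<open>The defining quotient \<open>X / (e^X - 1)\<close> is formed over the reals. Multiplying it out transfers it to
  complex power series, where the argument can be scaled by \<open>2\<pi>\<i>\<close>.\<close>

lemma bernoulli_egf:
  "(fps_exp 1 - 1) * Abs_fps (\<lambda>n. of_real (bernoulli n) / fact n) = (fps_X :: complex fps)"
proof -
  define G :: "real fps" where "G = fps_exp 1 - 1"
  have "fps_nth G 0 = 0" "fps_nth G 1 \<noteq> 0" by (simp_all add: G_def)
  hence "subdegree G = 1" "G \<noteq> 0" by (auto intro!: subdegreeI)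
  hence "G dvd fps_X" by (simp add: fps_dvd_iff)
  hence *: "G * (fps_X / G) = fps_X" by simp
  show ?thesis
  proof (rule fps_ext)
    fix n :: nat
    have "fps_nth ((fps_exp 1 - 1) * Abs_fps (\<lambda>n. of_real (bernoulli n) / fact n)) n
        = (of_real (fps_nth (G * (fps_X / G)) n) :: complex)"
      unfolding fps_mult_nth of_real_sum of_real_mult
      by (intro sum.cong arg_cong2[of _ _ _ _ "(*)"]) (auto simp: G_def bernoulli_def)
    thus "fps_nth ((fps_exp 1 - 1) * Abs_fps (\<lambda>n. of_real (bernoulli n) / fact n)) n
        = (fps_nth fps_X n :: complex)"
      by (simp only: * fps_X_nth) simp
  qed
qed

text \<open>Differentiate \<open>z / (\<Gamma>(1 + z) \<Gamma>(1 - z)) = sin(\<pi>z) / \<pi>\<close>, a form of Euler's reflection formula, and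
  multiply by \<open>\<pi>z\<close>. The identity says \<open>\<pi>z cot(\<pi>z) = 1 + z (\<psi>(1 - z) - \<psi>(1 + z))\<close> without
  denominators.\<close>

lemma deriv_sin_product:
  fixes z :: complex
  assumes "norm z < 1"
  shows "sin (of_real pi * z) * (1 + z * (Digamma (1 - z) - Digamma (1 + z)))
    = of_real pi * z * cos (of_real pi * z)"
proof -
  have nz: "1 + w \<notin> \<int>\<^sub>\<le>\<^sub>0" if "norm w < 1" for w :: complex
  proof
    assume "1 + w \<in> \<int>\<^sub>\<le>\<^sub>0"
    then obtain n where "1 + w = - of_nat n" by (elim nonpos_Ints_cases')
    hence "w = - of_nat n - 1" by (simp add: eq_diff_eq add.commute)
    hence "w = - of_nat (Suc n)" by simp
    hence "norm w = real (Suc n)" by (metis norm_minus_cancel norm_of_nat)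
    thus False using that by simp
  qed
  have n1: "1 + z \<notin> \<int>\<^sub>\<le>\<^sub>0" "1 - z \<notin> \<int>\<^sub>\<le>\<^sub>0" using nz[of z] nz[of "-z"] assms by auto
  define g where "g = (\<lambda>z. z * (rGamma (1 + z) * rGamma (1 - z)) :: complex)"
  have g: "g = (\<lambda>z. sin (of_real pi * z) / of_real pi)"
  proof
    fix z :: complex
    have "g z = rGamma z * rGamma (1 - z)"
      using rGamma_plus1[of z] by (simp add: g_def add.commute flip: mult.assoc)
    thus "g z = sin (of_real pi * z) / of_real pi" by (simp add: rGamma_reflection_complex)
  qed
  have "(g has_field_derivative rGamma (1 + z) * rGamma (1 - z) *
      (1 + z * (Digamma (1 - z) - Digamma (1 + z)))) (at z)"
    unfolding g_def using n1 by (auto intro!: derivative_eq_intros simp: algebra_simps)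
  moreover have "(g has_field_derivative cos (of_real pi * z)) (at z)"
    unfolding g by (auto intro!: derivative_eq_intros)
  ultimately have "rGamma (1 + z) * rGamma (1 - z) *
      (1 + z * (Digamma (1 - z) - Digamma (1 + z))) = cos (of_real pi * z)"
    by (rule DERIV_unique)
  moreover have "z * (rGamma (1 + z) * rGamma (1 - z)) = sin (of_real pi * z) / of_real pi"
    using fun_cong[OF g, of z] by (simp add: g_def)
  hence "sin (of_real pi * z) = of_real pi * z * (rGamma (1 + z) * rGamma (1 - z))"
    by (simp add: field_simps)
  ultimately show ?thesis by (simp only: mult.assoc)
qed

lemma zeta_eq_Polygamma:
  assumes "k \<ge> 2"
  shows "zeta (of_nat k) = (-1) ^ k * Polygamma (k - 1) 1 / fact (k - 1)"
proof -
  have "(\<lambda>n. inverse ((1 + of_nat n) ^ Suc (k - 1)))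
      sums ((-1) ^ Suc (k - 1) * Polygamma (k - 1) (1::complex) / fact (k - 1))"
    using assms by (intro Polygamma_LIMSEQ) auto
  moreover have "Suc (k - 1) = k" using assms by simp
  moreover have "inverse ((1 + of_nat n) ^ k) = 1 / of_nat (Suc n) powr (of_nat k :: complex)" for n
    using assms by (subst powr_nat') (auto simp: inverse_eq_divide)
  ultimately show ?thesis by (simp add: zeta_def sums_iff)
qed

text \<open>With \<open>c = 2\<pi>\<i>\<close>, the identity \<open>\<pi>z cot(\<pi>z) = cz/2 + cz / (e^(cz) - 1)\<close> matches the Taylor
  series of the Digamma terms with that of the Bernoulli numbers in \<open>cz\<close>. For even index \<open>k\<close> the
  former has coefficient \<open>-2\<zeta>(k)\<close>.\<close>

lemma zeta_even:
  assumes "even k" "k \<ge> 2"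
  shows "zeta (of_nat k) = - of_real (bernoulli k) * (2 * of_real pi * \<i>) ^ k / (2 * fact k)"
proof -
  define F where "F = fps_expansion Digamma (1::complex)"
  have F: "(\<lambda>z. Digamma (1 + z)) has_fps_expansion F"
    unfolding F_def by (rule analytic_at_imp_has_fps_expansion) (auto intro!: analytic_on_Polygamma)
  have F': "(\<lambda>z. Digamma (1 - z)) has_fps_expansion (fps_compose F (fps_const (-1) * fps_X))"
  proof -
    have "((\<lambda>z. Digamma (1 + z)) \<circ> (\<lambda>z. (-1) * z)) has_fps_expansion (fps_compose F (fps_const (-1) * fps_X))"
      by (intro has_fps_expansion_compose F fps_expansion_intros) auto
    thus ?thesis by (simp add: o_def)
  qed
  define c where "c = 2 * of_real pi * \<i>"
  \<comment> \<open>The expansion of \<open>\<pi>z cot(\<pi>z)\<close>.\<close>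
  define H where "H = 1 + fps_X * (fps_compose F (fps_const (-1) * fps_X) - F)"
  define B :: "complex fps" where "B = Abs_fps (\<lambda>n. of_real (bernoulli n) / fact n)"
  have "(\<lambda>z. (exp (c * z) - 1) * (1 + z * (Digamma (1 - z) - Digamma (1 + z)) - c / 2 * z))
          has_fps_expansion ((fps_exp c - 1) * (H - fps_const (c / 2) * fps_X))"
    unfolding H_def by (intro fps_expansion_intros F F')
  also have "?this \<longleftrightarrow> (\<lambda>z. c * z) has_fps_expansion ((fps_exp c - 1) * (H - fps_const (c / 2) * fps_X))"
  proof (rule has_fps_expansion_cong)
    have "eventually (\<lambda>z::complex. norm z < 1) (nhds 0)"
      using eventually_nhds_ball[of 1 "0::complex"] by (simp add: dist_norm)
    thus "eventually (\<lambda>z. (exp (c * z) - 1) * (1 + z * (Digamma (1 - z) - Digamma (1 + z)) - c / 2 * z)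
        = c * z) (nhds 0)"
    proof eventually_elim
      case (elim z)
      define w where "w = of_real pi * z"
      define h where "h = 1 + z * (Digamma (1 - z) - Digamma (1 + z))"
      have 1: "sin w * h = w * cos w" using deriv_sin_product[OF elim] by (simp add: w_def h_def)
      have c: "c * z = \<i> * w + \<i> * w" by (simp add: c_def w_def)
      have e: "exp (c * z) = exp (\<i> * w) ^ 2" unfolding c exp_add by (simp add: power2_eq_square)
      define E where "E = exp (\<i> * w)"
      have E: "E \<noteq> 0" by (simp add: E_def)
      have E': "exp (- (\<i> * w)) = inverse E" by (simp add: E_def exp_minus)
      have sc: "sin w = (E - inverse E) / (2 * \<i>)" "cos w = (E + inverse E) / 2"
        unfolding sin_exp_eq cos_exp_eq E' E_def[symmetric] by simp_all
      have "2 * \<i> * E * sin w = (2 * \<i>) * (E * (E - inverse E)) / (2 * \<i>)"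
        unfolding sc by (simp only: mult_ac times_divide_eq_right)
      hence "2 * \<i> * E * sin w = E * (E - inverse E)" by simp
      moreover have "2 * E * cos w = E * (E + inverse E)"
        unfolding sc by simp
      moreover have "E * (E - inverse E) = E ^ 2 - 1" "E * (E + inverse E) = E ^ 2 + 1"
        using E by (simp_all add: right_diff_distrib distrib_left power2_eq_square)
      ultimately have s: "2 * \<i> * E * sin w = E ^ 2 - 1" "2 * E * cos w = E ^ 2 + 1"
        by simp_all
      have "(E ^ 2 - 1) * h = 2 * \<i> * E * (sin w * h)"
        by (simp only: mult.assoc flip: s)
      also have "\<dots> = \<i> * w * (2 * E * cos w)"
        unfolding 1 by (simp only: mult_ac)
      also have "\<dots> = \<i> * w * (E ^ 2 + 1)"
        by (simp only: s)
      finally have "(E ^ 2 - 1) * h = \<i> * w * (E ^ 2 + 1)" .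
      hence "(E ^ 2 - 1) * (h - \<i> * w) = \<i> * w + \<i> * w" by (simp add: algebra_simps)
      thus ?case unfolding e h_def[symmetric] E_def[symmetric] using c by simp
    qed
  qed auto
  finally have "(\<lambda>z. c * z) has_fps_expansion ((fps_exp c - 1) * (H - fps_const (c / 2) * fps_X))" .
  moreover have "(\<lambda>z. c * z) has_fps_expansion (fps_const c * fps_X)"
    by (intro fps_expansion_intros)
  ultimately have 1: "(fps_exp c - 1) * (H - fps_const (c / 2) * fps_X) = fps_const c * fps_X"
    by (rule fps_expansion_unique_complex)
  have "fps_compose ((fps_exp 1 - 1) * B) (fps_const c * fps_X) = fps_const c * fps_X"
    unfolding B_def bernoulli_egf by simp
  hence 2: "(fps_exp c - 1) * fps_compose B (fps_const c * fps_X) = fps_const c * fps_X"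
    by (subst (asm) fps_compose_mult_distrib) (auto simp: fps_compose_sub_distrib)
  have c0: "c \<noteq> 0" by (simp add: c_def)
  have "fps_nth (fps_exp c - 1) 1 \<noteq> 0" using c0 by simp
  hence "fps_exp c - 1 \<noteq> 0" by force
  moreover from 1 2 have "(fps_exp c - 1) * (H - fps_const (c / 2) * fps_X)
      = (fps_exp c - 1) * fps_compose B (fps_const c * fps_X)" by simp
  ultimately have "H - fps_const (c / 2) * fps_X = fps_compose B (fps_const c * fps_X)"
    by simp
  hence "fps_nth (H - fps_const (c / 2) * fps_X) k = fps_nth (fps_compose B (fps_const c * fps_X)) k"
    by simp
  moreover obtain n where n: "k = Suc (Suc n)" using assms
    by (metis add_2_eq_Suc le_Suc_ex)
  have "fps_nth F (Suc n) = Polygamma (Suc n) 1 / fact (Suc n)"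
    unfolding F_def fps_expansion_def by (subst higher_deriv_Polygamma) auto
  moreover have "zeta (of_nat k) = Polygamma (Suc n) 1 / fact (Suc n)"
    using zeta_eq_Polygamma[OF assms(2)] assms(1) by (simp add: n)
  ultimately have "- 2 * zeta (of_nat k) = of_real (bernoulli k) * c ^ k / fact k"
    using assms(1) by (simp add: n H_def B_def fps_compose_linear) (simp add: mult_ac)
  hence "zeta (of_nat k) = - (of_real (bernoulli k) * c ^ k / fact k) / 2"
    by (simp flip: \<open>- 2 * zeta (of_nat k) = _\<close>)
  thus ?thesis by (simp add: c_def)
qed

lemma inverse_zeta_even:
  assumes "even k" "k \<ge> 2"
  shows "1 / zeta (of_nat k) = (-1) ^ (k div 2 + 1) *
           (fact k / (of_real (bernoulli k) * 2 ^ (k - 1))) * (1 / of_real pi ^ k)"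
proof -
  obtain m where m: "k = 2 * m" using assms by auto
  hence "m > 0" using assms by auto
  have i: "\<i> ^ k = (-1) ^ m" by (simp add: m power_mult)
  have 2: "(2::complex) ^ k = 2 * 2 ^ (k - 1)" using assms by (cases k) auto
  show ?thesis
    unfolding zeta_even[OF assms] power_mult_distrib i 2
    by (cases "even m") (simp_all add: m field_simps)
qed

section \<open>The limit over all primes\<close>

theorem corollary1p5:
  fixes k :: nat
  assumes "k \<ge> 2"
  shows "\<exists>L :: nat \<Rightarrow> complex.
           (\<forall>N\<ge>2. tendsto_at_1_in_disk (F_series (S_fr k N)) (L N)) \<and>
           L \<longlonglongrightarrow> 1 / zeta (of_nat k) \<and>
           (even k \<longrightarrow>
              L \<longlonglongrightarrow> (-1) ^ (k div 2 + 1) *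
                (fact k / (of_real (bernoulli k) * 2 ^ (k - 1))) * (1 / of_real pi ^ k))"
proof -
  define L :: "nat \<Rightarrow> complex" where "L = (\<lambda>N. \<Prod>p | prime p \<and> p \<le> N. 1 - 1 / of_nat p ^ k)"
  have lim: "(\<lambda>N. zeta (of_nat k) * L N) \<longlonglongrightarrow> 1" unfolding L_def by (rule euler_product_zeta[OF assms])
  have "zeta (of_nat k) \<noteq> 0"
  proof
    assume "zeta (of_nat k) = 0"
    with lim show False by (simp add: LIMSEQ_const_iff)
  qed
  hence "L \<longlonglongrightarrow> 1 / zeta (of_nat k)"
    using tendsto_divide[OF lim tendsto_const[of "zeta (of_nat k)"]] by simp
  moreover have "\<forall>N\<ge>2. tendsto_at_1_in_disk (F_series (S_fr k N)) (L N)"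
    unfolding L_def using assms by (intro allI impI F_series_S_fr_limit) auto
  ultimately show ?thesis using inverse_zeta_even[OF _ assms] by (intro exI[of _ L]) auto
qed

end
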